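(* Let $(W,S)$ be a Coxeter system with $|S|<\infty$ and $\theta:W\to W$ a group automorphism with $\theta^2=\mathrm{id}$ and $\theta(S)=S$. Let $\mathfrak{I}(\theta)=\{w\in W\mid\theta(w)=w^{-1}\}$ and let $\mathrm{Br}(\mathfrak{I}(\theta))$ be the subposet of the Bruhat order on $W$ induced by $\mathfrak{I}(\theta)$ (which is graded with minimum the identity $e$). Then the rank of $w\in\mathrm{Br}(\mathfrak{I}(\theta))$ equals $(\ell(w)+\ell^\theta(w))/2$.
   Context: $\ell$ is the Coxeter length on $W$. Bruhat order: $v\le w$ iff some reduced expression of $w$ contains a subexpression which is a reduced expression of $v$. Let $\iota(\theta)=\{x\theta(x^{-1})\mid x\in W\}$. The twisted absolute length $\ell^\theta(w)$ is the smallest number of factors that must be deleted from a reduced expression of $w$ in order to obtain an element of $\iota(\theta)$ (independent of the reduced expression chosen). *)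

theory Defs
  imports "HOL-Algebra.Algebra" "HOL-Library.Sublist" "HOL-Library.Extended_Nat"
begin

definition word_prod :: "('a, 'b) monoid_scheme \<Rightarrow> 'a list \<Rightarrow> 'a" where
  "word_prod G ss = foldr (\<lambda>s x. s \<otimes>\<^bsub>G\<^esub> x) ss \<one>\<^bsub>G\<^esub>"

definition coxeter_matrix :: "'a set \<Rightarrow> ('a \<Rightarrow> 'a \<Rightarrow> enat) \<Rightarrow> bool" where
  "coxeter_matrix S m \<longleftrightarrow>
     (\<forall>s\<in>S. m s s = 1) \<and>
     (\<forall>s\<in>S. \<forall>t\<in>S. s \<noteq> t \<longrightarrow> m s t = m t s \<and> 2 \<le> m s t)"

text \<open>
  The congruence on the free monoid over \<open>S\<close> generated by the relations
  \<open>(s t)^m(s,t) = 1\<close>, one for each pair with \<open>m(s,t)\<close> finite. Since \<open>m(s,s) = 1\<close>,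
  every generator is its own inverse modulo this congruence; hence the quotient monoid is the
  group presented by the same relations, and no inverse letters are needed.
\<close>

inductive coxeter_cong :: "'a set \<Rightarrow> ('a \<Rightarrow> 'a \<Rightarrow> enat) \<Rightarrow> 'a list \<Rightarrow> 'a list \<Rightarrow> bool"
  for S :: "'a set" and m :: "'a \<Rightarrow> 'a \<Rightarrow> enat" where
  rel: "us \<in> lists S \<Longrightarrow> vs \<in> lists S \<Longrightarrow> s \<in> S \<Longrightarrow> t \<in> S \<Longrightarrow> m s t = enat k \<Longrightarrow>
        coxeter_cong S m (us @ concat (replicate k [s, t]) @ vs) (us @ vs)"
| refl: "us \<in> lists S \<Longrightarrow> coxeter_cong S m us us"
| sym: "coxeter_cong S m us vs \<Longrightarrow> coxeter_cong S m vs us"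
| trans: "coxeter_cong S m us vs \<Longrightarrow> coxeter_cong S m vs ws \<Longrightarrow> coxeter_cong S m us ws"

text \<open>
  \<open>(G, S)\<close> is a Coxeter system: \<open>G\<close> is generated by \<open>S\<close> and, for some Coxeter matrix \<open>m\<close>, two
  words in \<open>S\<close> have equal products exactly if the defining relations identify them.
\<close>

definition coxeter_system :: "('a, 'b) monoid_scheme \<Rightarrow> 'a set \<Rightarrow> bool" where
  "coxeter_system G S \<longleftrightarrow>
     group G \<and> S \<subseteq> carrier G \<and> generate G S = carrier G \<and>
     (\<exists>m. coxeter_matrix S m \<and>
        (\<forall>us\<in>lists S. \<forall>vs\<in>lists S.
           word_prod G us = word_prod G vs \<longleftrightarrow> coxeter_cong S m us vs))"

definition coxeter_length :: "('a, 'b) monoid_scheme \<Rightarrow> 'a set \<Rightarrow> 'a \<Rightarrow> nat" where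
  "coxeter_length G S w = (LEAST n. \<exists>ss\<in>lists S. word_prod G ss = w \<and> length ss = n)"

definition reduced_expression ::
  "('a, 'b) monoid_scheme \<Rightarrow> 'a set \<Rightarrow> 'a \<Rightarrow> 'a list \<Rightarrow> bool" where
  "reduced_expression G S w ss \<longleftrightarrow>
     ss \<in> lists S \<and> word_prod G ss = w \<and> length ss = coxeter_length G S w"

definition bruhat_le :: "('a, 'b) monoid_scheme \<Rightarrow> 'a set \<Rightarrow> 'a \<Rightarrow> 'a \<Rightarrow> bool" where
  "bruhat_le G S v w \<longleftrightarrow>
     (\<exists>ss ts. reduced_expression G S w ss \<and> subseq ts ss \<and> reduced_expression G S v ts)"

definition twisted_involutions :: "('a, 'b) monoid_scheme \<Rightarrow> ('a \<Rightarrow> 'a) \<Rightarrow> 'a set" where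
  "twisted_involutions G \<theta> = {w \<in> carrier G. \<theta> w = inv\<^bsub>G\<^esub> w}"

definition twisted_identities :: "('a, 'b) monoid_scheme \<Rightarrow> ('a \<Rightarrow> 'a) \<Rightarrow> 'a set" where
  "twisted_identities G \<theta> = {x \<otimes>\<^bsub>G\<^esub> \<theta> (inv\<^bsub>G\<^esub> x) | x. x \<in> carrier G}"

text \<open>
  Deleting \<open>d\<close> factors from \<open>ss\<close> leaves a subsequence \<open>ts\<close> with \<open>length ts + d = length ss\<close>. The
  minimum is taken over all deletions from all reduced expressions of \<open>w\<close>; this agrees with the
  minimum for any single reduced expression, as the latter does not depend on the expression.
\<close>

definition twisted_absolute_length ::
  "('a, 'b) monoid_scheme \<Rightarrow> 'a set \<Rightarrow> ('a \<Rightarrow> 'a) \<Rightarrow> 'a \<Rightarrow> nat" where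
  "twisted_absolute_length G S \<theta> w =
     (LEAST d. \<exists>ss ts. reduced_expression G S w ss \<and> subseq ts ss \<and>
        length ts + d = length ss \<and> word_prod G ts \<in> twisted_identities G \<theta>)"

definition Br_twisted_involutions ::
  "('a, 'b) monoid_scheme \<Rightarrow> 'a set \<Rightarrow> ('a \<Rightarrow> 'a) \<Rightarrow> 'a gorder" where
  "Br_twisted_involutions G S \<theta> =
     \<lparr>carrier = twisted_involutions G \<theta>, eq = (=), le = bruhat_le G S\<rparr>"

definition covered_by :: "('a, 'b) gorder_scheme \<Rightarrow> 'a \<Rightarrow> 'a \<Rightarrow> bool" where
  "covered_by L x y \<longleftrightarrow> x \<in> carrier L \<and> y \<in> carrier L \<and> x \<sqsubset>\<^bsub>L\<^esub> y \<and>
     \<not> (\<exists>z\<in>carrier L. x \<sqsubset>\<^bsub>L\<^esub> z \<and> z \<sqsubset>\<^bsub>L\<^esub> y)"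

definition rank_function :: "('a, 'b) gorder_scheme \<Rightarrow> ('a \<Rightarrow> nat) \<Rightarrow> bool" where
  "rank_function L \<rho> \<longleftrightarrow>
     (\<forall>x\<in>carrier L. \<not> (\<exists>y\<in>carrier L. y \<sqsubset>\<^bsub>L\<^esub> x) \<longrightarrow> \<rho> x = 0) \<and>
     (\<forall>x\<in>carrier L. \<forall>y\<in>carrier L. x \<sqsubset>\<^bsub>L\<^esub> y \<longrightarrow> \<rho> x < \<rho> y) \<and>
     (\<forall>x y. covered_by L x y \<longrightarrow> \<rho> y = Suc (\<rho> x))"

definition graded_poset :: "('a, 'b) gorder_scheme \<Rightarrow> bool" where
  "graded_poset L \<longleftrightarrow> partial_order L \<and> (\<exists>\<rho>. rank_function L \<rho>)"

lemma rank_function_unique: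
  assumes \<rho>: "rank_function L \<rho>" and \<sigma>: "rank_function L \<sigma>" and "x \<in> carrier L"
  shows "\<rho> x = \<sigma> x"
  using \<open>x \<in> carrier L\<close>
proof (induction "\<rho> x" arbitrary: x rule: less_induct)
  case less
  show ?case
  proof (cases "\<exists>y\<in>carrier L. y \<sqsubset>\<^bsub>L\<^esub> x")
    case False
    then show ?thesis
      using \<rho> \<sigma> less.prems unfolding rank_function_def by simp
  next
    case True
    let ?P = "\<lambda>y. y \<in> carrier L \<and> y \<sqsubset>\<^bsub>L\<^esub> x"
    have mono: "\<rho> a < \<rho> b" if "a \<in> carrier L" "b \<in> carrier L" "a \<sqsubset>\<^bsub>L\<^esub> b" for a b
      using \<rho> that unfolding rank_function_def by blast
    define R where "R = \<rho> ` {y. ?P y}"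
    have "R \<subseteq> {..\<rho> x}"
      using mono less.prems unfolding R_def by (auto intro: less_imp_le)
    then have fin: "finite R" by (rule finite_subset) simp
    have "R \<noteq> {}" using True unfolding R_def by blast
    then have "Max R \<in> R" using fin by (rule Max_in[rotated])
    then obtain y where y: "?P y" and yM: "\<rho> y = Max R" unfolding R_def by auto
    have max: "\<rho> z \<le> \<rho> y" if "?P z" for z
      unfolding yM using fin that by (intro Max_ge) (auto simp: R_def)
    have "covered_by L y x"
      unfolding covered_by_def
    proof (intro conjI notI)
      assume "\<exists>z\<in>carrier L. y \<sqsubset>\<^bsub>L\<^esub> z \<and> z \<sqsubset>\<^bsub>L\<^esub> x"
      then obtain z where z: "z \<in> carrier L" "y \<sqsubset>\<^bsub>L\<^esub> z" "z \<sqsubset>\<^bsub>L\<^esub> x" by blast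
      then have "\<rho> y < \<rho> z" using mono y by simp
      with max[of z] z show False by simp
    qed (use y less.prems in simp_all)
    then have "\<rho> x = Suc (\<rho> y)" "\<sigma> x = Suc (\<sigma> y)"
      using \<rho> \<sigma> unfolding rank_function_def by simp_all
    then show ?thesis using less.hyps[of y] y by simp
  qed
qed

definition poset_rank :: "('a, 'b) gorder_scheme \<Rightarrow> 'a \<Rightarrow> nat" where
  "poset_rank L x = (THE r. \<exists>\<rho>. rank_function L \<rho> \<and> r = \<rho> x)"

lemma poset_rank_eq:
  assumes "rank_function L \<rho>" and "x \<in> carrier L"
  shows "poset_rank L x = \<rho> x"
  unfolding poset_rank_def
proof (rule the_equality)
  show "\<exists>\<sigma>. rank_function L \<sigma> \<and> \<rho> x = \<sigma> x" using assms by blast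
next
  fix r assume "\<exists>\<sigma>. rank_function L \<sigma> \<and> r = \<sigma> x"
  then obtain \<sigma> where "rank_function L \<sigma>" "r = \<sigma> x" by blast
  then show "r = \<rho> x" using rank_function_unique[of L \<sigma> \<rho> x] assms by simp
qed

end

theory Submission
  imports Defs "HOL-Library.Function_Algebras" Complex_Main
begin

text \<open>
  Everything is read off the geometric representation of \<open>W\<close> on real functions on \<open>S\<close>, whose roots
  are positive or negative according to the behaviour of the length; this yields the strong exchange
  property, hence the subword and lifting properties of the Bruhat order.

  For a twisted involution \<open>w\<close> and \<open>s \<in> S\<close> put \<open>w * s = s w \<theta>(s)\<close>, or \<open>w * s = s w\<close> if
  \<open>s w \<theta>(s) = w\<close>. The number \<open>\<delta>(w) = rank (1 - w \<theta>) - rank (1 - \<theta>)\<close> is unchanged in the first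
  case. In the second case, if \<open>s w\<close> is longer than \<open>w\<close>, the root of \<open>s\<close> is fixed by \<open>w \<theta>\<close> and
  negated by \<open>s w \<theta>\<close>, so \<open>\<delta>\<close> grows by one. Hence \<open>\<ell> + \<delta>\<close> grows by two at every upward step, and
  the lifting property shows that \<open>(\<ell> + \<delta>) / 2\<close> is the rank function. Deleting a letter from a word
  lowers \<open>rank (1 - w \<theta>)\<close> by at most one and this rank is constant on \<open>\<iota>(\<theta>)\<close>, so
  \<open>\<delta> \<le> \<ell>\<^sup>\<theta>\<close>; deleting one letter per step of the second kind gives equality.
\<close>

section \<open>Words and length\<close>

text \<open>The obstacle is dependence on choices: the number of steps of the second kind on the way
  from the identity to \<open>w\<close> seems to depend on the descents chosen, and \<ell>^\<theta>
  is a minimum over deletions. A rank depends on no choice, which makes it a suitable invariant for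
  both. The group may be infinite and the bilinear form degenerate, so nothing can rest on
  orthogonal complements in the whole space. What remains available is that a dihedral plane of
  finite order is nondegenerate, that roots have a sign, and that \<open>w \<theta>\<close> is a
  linear involution when \<open>w\<close> is a twisted involution. The form is built from the orders
  of the products \<open>s t\<close> in the group itself; a relation of the presentation enters only
  through the fact that its exponent is a multiple of such an order. Both the strict growth of the
  rank and its jump by one along covers come from one statement: every interval from
  \<open>x\<close> up to a larger \<open>y\<close> contains an element whose rank is one less than
  that of \<open>y\<close>.\<close>

declare in_lists_conv_set [simp del] in_listsI [rule del] in_listsD [rule del]

lemma rev_in_lists_iff [simp]: "rev xs \<in> lists A \<longleftrightarrow> xs \<in> lists A"
  by (simp add: in_lists_conv_set)

locale coxeter_group = group W for W :: "('a, 'b) monoid_scheme" (structure) +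
  fixes S :: "'a set"
  assumes system: "coxeter_system W S"
    and finite_gens: "finite S"
begin

abbreviation len :: "'a \<Rightarrow> nat" where "len \<equiv> coxeter_length W S"

lemma gens_subset: "S \<subseteq> carrier W"
  using system unfolding coxeter_system_def by blast

lemma gen_closed [simp, intro]: "s \<in> S \<Longrightarrow> s \<in> carrier W"
  using gens_subset by blast

lemma word_prod_Nil [simp]: "word_prod W [] = \<one>"
  and word_prod_Cons [simp]: "word_prod W (s # ss) = s \<otimes> word_prod W ss"
  by (simp_all add: word_prod_def)

lemma word_prod_closed [simp, intro]: "ss \<in> lists S \<Longrightarrow> word_prod W ss \<in> carrier W"
  by (induction ss) auto

lemma word_prod_append [simp]:
  "us \<in> lists S \<Longrightarrow> vs \<in> lists S \<Longrightarrow> word_prod W (us @ vs) = word_prod W us \<otimes> word_prod W vs"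
  by (induction us) (auto simp: m_assoc)

lemma presentation:
  obtains m where "coxeter_matrix S m"
    and "\<forall>us\<in>lists S. \<forall>vs\<in>lists S.
           word_prod W us = word_prod W vs \<longleftrightarrow> coxeter_cong S m us vs"
  using system unfolding coxeter_system_def by blast

lemma gen_square [simp]: assumes "s \<in> S" shows "s \<otimes> s = \<one>"
proof -
  obtain m where m: "coxeter_matrix S m"
    "\<forall>us\<in>lists S. \<forall>vs\<in>lists S.
       word_prod W us = word_prod W vs \<longleftrightarrow> coxeter_cong S m us vs"
    by (rule presentation)
  have "m s s = enat 1" using m(1) assms by (simp add: coxeter_matrix_def one_enat_def)
  with coxeter_cong.rel[of "[]" S "[]" s s m 1] have "coxeter_cong S m [s, s] []"
    using assms by simp
  then have "word_prod W [s, s] = word_prod W []" using m(2)[rule_format, of "[s, s]" "[]"] assms by simp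
  then show ?thesis using assms by simp
qed

lemma gen_cancel [simp]:
  assumes "s \<in> S" "x \<in> carrier W"
  shows "s \<otimes> (s \<otimes> x) = x" and "x \<otimes> s \<otimes> s = x"
  using assms by (simp add: m_assoc[symmetric], simp add: m_assoc)

lemma gen_inv [simp]: "s \<in> S \<Longrightarrow> inv s = s"
  by (simp add: inv_equality)

lemma word_prod_rev: "ss \<in> lists S \<Longrightarrow> word_prod W (rev ss) = inv (word_prod W ss)"
  by (induction ss) (auto simp: inv_mult_group)

text \<open>\<open>generate\<close> also admits inverses of generators; these are the generators
  themselves, so words without inverse letters suffice.\<close>

lemma word_exists: assumes "w \<in> carrier W" obtains ss where "ss \<in> lists S" "word_prod W ss = w"
proof -
  have "w \<in> generate W S" using assms system by (simp add: coxeter_system_def)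
  then have "\<exists>ss\<in>lists S. word_prod W ss = w"
  proof (induction rule: generate.induct)
    case one
    show ?case by (rule bexI[of _ "[]"]) auto
  next
    case (incl h)
    then show ?case by (intro bexI[of _ "[h]"]) auto
  next
    case (inv h)
    then show ?case by (intro bexI[of _ "[h]"]) auto
  next
    case (eng h1 h2)
    then obtain us vs where "us \<in> lists S" "vs \<in> lists S" "word_prod W us = h1" "word_prod W vs = h2"
      by blast
    then show ?case by (intro bexI[of _ "us @ vs"]) auto
  qed
  then show thesis using that by blast
qed

lemma len_le: "ss \<in> lists S \<Longrightarrow> len (word_prod W ss) \<le> length ss"
  unfolding coxeter_length_def by (rule Least_le) blast

lemma reduced_exists: assumes "w \<in> carrier W" obtains ss where "reduced_expression W S w ss"
proof -
  obtain us where us: "us \<in> lists S" "word_prod W us = w" using word_exists assms by blast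
  have "\<exists>ss\<in>lists S. word_prod W ss = w \<and> length ss = len w"
    unfolding coxeter_length_def by (rule LeastI[of _ "length us"]) (use us in blast)
  then show thesis using that unfolding reduced_expression_def by blast
qed

text \<open>Every relator has even length \<open>2 * k\<close>, which makes the sign character of
  the group well defined. It later excludes that \<open>w\<close> and \<open>s w\<close> have equal
  length, so each generator is either an ascent or a descent.\<close>

lemma cong_parity:
  assumes "coxeter_cong S m us vs" shows "even (length us) = even (length vs)"
  using assms
proof induction
  case (rel us vs s t k)
  have "length (concat (replicate k [s, t])) = 2 * k" by (induction k) auto
  then show ?case by simp
qed auto

lemma word_prod_parity:
  assumes "us \<in> lists S" "vs \<in> lists S" "word_prod W us = word_prod W vs"
  shows "even (length us) = even (length vs)"
proof -
  obtain m where "\<forall>us\<in>lists S. \<forall>vs\<in>lists S.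
       word_prod W us = word_prod W vs \<longleftrightarrow> coxeter_cong S m us vs"
    by (rule presentation)
  then have "coxeter_cong S m us vs" using assms by simp
  then show ?thesis by (rule cong_parity)
qed

lemma len_parity:
  assumes "ss \<in> lists S" shows "even (len (word_prod W ss)) = even (length ss)"
proof -
  obtain us where "us \<in> lists S" "word_prod W us = word_prod W ss" "length us = len (word_prod W ss)"
    using reduced_exists[of "word_prod W ss"] assms unfolding reduced_expression_def by auto
  then show ?thesis using word_prod_parity assms by metis
qed

lemma len_mult_le:
  assumes "x \<in> carrier W" "y \<in> carrier W" shows "len (x \<otimes> y) \<le> len x + len y"
proof -
  obtain us vs where "reduced_expression W S x us" "reduced_expression W S y vs"
    using reduced_exists assms by meson
  then show ?thesis using len_le[of "us @ vs"] unfolding reduced_expression_def by simp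
qed

lemma len_mult_parity:
  assumes "x \<in> carrier W" "y \<in> carrier W" shows "even (len (x \<otimes> y)) = even (len x + len y)"
proof -
  obtain us vs where "reduced_expression W S x us" "reduced_expression W S y vs"
    using reduced_exists assms by meson
  then show ?thesis using len_parity[of "us @ vs"] unfolding reduced_expression_def by simp
qed

lemma len_one [simp]: "len \<one> = 0"
  using len_le[of "[]"] by simp

lemma len_gen: assumes "s \<in> S" shows "len s = 1"
  using len_le[of "[s]"] len_parity[of "[s]"] assms
  by (cases "len s") auto

lemma len_inv: assumes "w \<in> carrier W" shows "len (inv w) = len w"
proof -
  have le: "len (inv x) \<le> len x" if x: "x \<in> carrier W" for x
  proof -
    obtain ss where ss: "reduced_expression W S x ss" using reduced_exists x by blast
    then have "word_prod W (rev ss) = inv x" using word_prod_rev by (simp add: reduced_expression_def)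
    then show ?thesis using len_le[of "rev ss"] ss by (auto simp: reduced_expression_def)
  qed
  show ?thesis using le[of w] le[of "inv w"] assms by simp
qed

lemma len_gen_mult:
  assumes "s \<in> S" "w \<in> carrier W"
  shows "len (s \<otimes> w) = Suc (len w) \<or> len w = Suc (len (s \<otimes> w))"
proof -
  have "len (s \<otimes> w) \<le> Suc (len w)" using len_mult_le[of s w] len_gen assms by simp
  moreover have "len w \<le> Suc (len (s \<otimes> w))"
    using len_mult_le[of s "s \<otimes> w"] len_gen assms by simp
  moreover have "even (len (s \<otimes> w)) = odd (len w)"
    using len_mult_parity[of s w] len_gen assms by simp
  ultimately show ?thesis by presburger
qed

lemma len_mult_gen:
  assumes "s \<in> S" "w \<in> carrier W"
  shows "len (w \<otimes> s) = Suc (len w) \<or> len w = Suc (len (w \<otimes> s))"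
  using len_gen_mult[of s "inv w"] len_inv[of w] len_inv[of "w \<otimes> s"] assms
  by (simp add: inv_mult_group)

lemma left_descent_exists:
  assumes "w \<in> carrier W" "w \<noteq> \<one>" obtains s where "s \<in> S" "len (s \<otimes> w) < len w"
proof -
  obtain ss where ss: "reduced_expression W S w ss" using reduced_exists assms by blast
  with assms(2) obtain s ts where "ss = s # ts"
    by (cases ss) (auto simp: reduced_expression_def)
  then show thesis
    using that[of s] ss len_le[of ts] by (auto simp: reduced_expression_def)
qed

lemma right_descent_exists:
  assumes "w \<in> carrier W" "w \<noteq> \<one>" obtains s where "s \<in> S" "len (w \<otimes> s) < len w"
proof -
  have "inv w \<noteq> \<one>" using assms by (metis inv_inv inv_one)
  then obtain s where s: "s \<in> S" "len (s \<otimes> inv w) < len (inv w)"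
    using left_descent_exists assms by (metis inv_closed)
  then show thesis
    using that[of s] len_inv[of w] len_inv[of "w \<otimes> s"] assms by (simp add: inv_mult_group)
qed

end

section \<open>The geometric representation\<close>

text \<open>Vectors are functions on the whole type, with the simple roots at the points of
  \<open>S\<close>. The pointwise order then expresses that a root is positive
  (\<open>0 \<le> v\<close>) or negative (\<open>v \<le> 0\<close>).\<close>

definition scale_fun :: "real \<Rightarrow> ('x \<Rightarrow> real) \<Rightarrow> 'x \<Rightarrow> real" (infixr "*\<^sub>F" 75) where
  "c *\<^sub>F v = (\<lambda>x. c * v x)"

lemma scale_fun_apply [simp]: "(c *\<^sub>F v) x = c * v x"
  by (simp add: scale_fun_def)

interpretation fun_vs: vector_space scale_fun
  by unfold_locales (auto simp: algebra_simps)

abbreviation linear_fun :: "(('x \<Rightarrow> real) \<Rightarrow> ('x \<Rightarrow> real)) \<Rightarrow> bool" where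
  "linear_fun \<equiv> Vector_Spaces.linear scale_fun scale_fun"

lemma linear_funI:
  assumes "\<And>u v. f (u + v) = f u + f v" "\<And>c v. f (c *\<^sub>F v) = c *\<^sub>F f v"
  shows "linear_fun f"
  using assms by unfold_locales auto

lemma linear_fun_add: "linear_fun f \<Longrightarrow> f (u + v) = f u + f v"
  and linear_fun_scale: "linear_fun f \<Longrightarrow> f (c *\<^sub>F v) = c *\<^sub>F f v"
  and linear_fun_diff: "linear_fun f \<Longrightarrow> f (u - v) = f u - f v"
  and linear_fun_neg: "linear_fun f \<Longrightarrow> f (- v) = - f v"
  and linear_fun_zero: "linear_fun f \<Longrightarrow> f 0 = 0"
  unfolding module_hom_iff_linear[symmetric]
  by (fact module_hom.add, fact module_hom.scale, fact module_hom.diff, fact module_hom.neg,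
      fact module_hom.zero)

lemma linear_fun_compose:
  assumes "linear_fun f" "linear_fun g" shows "linear_fun (\<lambda>v. f (g v))"
  by (rule linear_funI)
    (simp_all only: linear_fun_add[OF assms(1)] linear_fun_add[OF assms(2)]
      linear_fun_scale[OF assms(1)] linear_fun_scale[OF assms(2)])

definition unit_fun :: "'x \<Rightarrow> 'x \<Rightarrow> real" where
  "unit_fun s = (\<lambda>x. if x = s then 1 else 0)"

lemma unit_fun_apply: "unit_fun s x = (if x = s then 1 else 0)"
  by (simp add: unit_fun_def)

section \<open>Chebyshev polynomials and alternating words\<close>

fun chebyshev :: "real \<Rightarrow> nat \<Rightarrow> real" where
  "chebyshev c 0 = 0"
| "chebyshev c (Suc 0) = 1"
| "chebyshev c (Suc (Suc k)) = c * chebyshev c (Suc k) - chebyshev c k"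

text \<open>The limit case of angle 0, which serves pairs of generators whose product has infinite
  order.\<close>

lemma chebyshev_2: "chebyshev 2 k = real k"
  by (induction "2::real" k rule: chebyshev.induct) auto

text \<open>\<open>chebyshev c k\<close> is the Chebyshev polynomial of the second kind of index k -
  1, taken at \<open>c / 2\<close>. Multiplying by \<open>sin x\<close> instead of dividing keeps
  the identity valid where the sine vanishes; the step expands the sine at (k + 1) x + x and (k + 1)
  x - x.\<close>

lemma chebyshev_cos: "chebyshev (2 * cos x) k * sin x = sin (real k * x)"
proof (induction k rule: induct_nat_012)
  case (ge2 k)
  have "sin (real (Suc (Suc k)) * x) = 2 * cos x * sin (real (Suc k) * x) - sin (real k * x)"
  proof -
    have "real (Suc (Suc k)) * x = real (Suc k) * x + x" "real k * x = real (Suc k) * x - x"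
      by (auto simp: algebra_simps)
    then show ?thesis by (simp only: sin_add sin_diff) (simp add: algebra_simps)
  qed
  then show ?case using ge2 by (simp add: algebra_simps)
qed auto

text \<open>The recursion works at the right end, so the second letter argument is always the last
  letter. It is the one that acts first on a vector, which makes peeling off letters match the
  recursion of \<open>chebyshev\<close>.\<close>

fun alternating :: "nat \<Rightarrow> 'x \<Rightarrow> 'x \<Rightarrow> 'x list" where
  "alternating 0 s t = []"
| "alternating (Suc k) s t = alternating k t s @ [t]"

lemma length_alternating [simp]: "length (alternating k s t) = k"
  by (induction k arbitrary: s t) auto

lemma alternating_in_lists: "s \<in> A \<Longrightarrow> t \<in> A \<Longrightarrow> alternating k s t \<in> lists A"
  by (induction k arbitrary: s t) auto

lemma alternating_double: "alternating (2 * k) s t = concat (replicate k [s, t])"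
proof (induction k)
  case (Suc k)
  have "concat (replicate k [s, t]) @ [s, t] = concat (replicate (Suc k) [s, t])"
    by (induction k) auto
  then show ?case using Suc by simp
qed auto

lemma alternating_Cons: "alternating (Suc k) s t = (if even k then t else s) # alternating k s t"
  by (induction k arbitrary: s t) auto

lemma rev_alternating:
  "rev (alternating k s t) = (if even k then alternating k t s else alternating k s t)"
proof (induction k)
  case (Suc k)
  then show ?case by (subst alternating_Cons) auto
qed auto

lemma alternating_add:
  "alternating (j + k) s t =
     (if even k then alternating j s t else alternating j t s) @ alternating k s t"
  by (induction k arbitrary: s t) auto

lemma sin_pi_div_pos: assumes "2 \<le> (m::nat)" shows "0 < sin (pi / real m)"
proof (rule sin_gt_zero)
  have "pi * 1 < pi * real m" using assms by (intro mult_strict_left_mono) auto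
  then show "pi / real m < pi" using assms by (simp add: divide_less_eq)
qed (use assms in simp)

text \<open>For the angle x = pi / m the index \<open>2 * m\<close> is one full turn; the three
  values are those of the sine at 2 pi, 2 pi + x and 2 pi - x, divided by
  \<open>sin x\<close>.\<close>

lemma chebyshev_period:
  assumes "2 \<le> (m::nat)" and c: "c = 2 * cos (pi / real m)"
  shows "chebyshev c (2 * m) = 0" and "chebyshev c (Suc (2 * m)) = 1"
    and "chebyshev c (2 * m - 1) = - 1"
proof -
  define x where "x = pi / real m"
  have mx: "real m * x = pi" using assms by (simp add: x_def)
  have sx: "0 < sin x" unfolding x_def using assms(1) by (rule sin_pi_div_pos)
  have cheb: "chebyshev c k = sin (real k * x) / sin x" for k
    using chebyshev_cos[of x k] sx c by (simp add: field_simps x_def)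
  have "real (2 * m) * x = 2 * pi" using mx by simp
  then show "chebyshev c (2 * m) = 0" by (subst cheb) (simp only: sin_two_pi div_0)
  have "real (Suc (2 * m)) * x = 2 * pi + x" using mx by (simp add: algebra_simps)
  then show "chebyshev c (Suc (2 * m)) = 1" unfolding cheb using sx by (simp add: sin_add)
  have "real (2 * m - 1) = 2 * real m - 1" using assms by (simp add: of_nat_diff)
  then have "real (2 * m - 1) * x = 2 * pi - x" using mx by (simp add: algebra_simps)
  then show "chebyshev c (2 * m - 1) = - 1" unfolding cheb using sx by (simp add: sin_diff)
qed

section \<open>The reflections of the generators\<close>

context coxeter_group
begin

text \<open>
  The order is \<open>0\<close> when \<open>s t\<close> has infinite order; then \<open>pi / 0 = 0\<close> and the value is \<open>-1\<close>, as it
  should be.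
\<close>

definition cosine :: "'a \<Rightarrow> 'a \<Rightarrow> real" where
  "cosine s t = - cos (pi / real (ord (s \<otimes> t)))"

text \<open>The functional B(\<alpha>, -) for the simple root \<alpha> of \<open>s\<close> and the
  bilinear form B with matrix \<open>cosine\<close>. It reads only coordinates in \<open>S\<close>,
  and \<open>reflect s\<close> alters only the coordinate \<open>s\<close>; the latter drives the
  sign argument for roots.\<close>

definition coroot :: "'a \<Rightarrow> ('a \<Rightarrow> real) \<Rightarrow> real" where
  "coroot s v = (\<Sum>t\<in>S. cosine s t * v t)"

definition reflect :: "'a \<Rightarrow> ('a \<Rightarrow> real) \<Rightarrow> 'a \<Rightarrow> real" where
  "reflect s v = v - (2 * coroot s v) *\<^sub>F unit_fun s"

lemma cosine_same [simp]: "s \<in> S \<Longrightarrow> cosine s s = 1"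
  by (simp add: cosine_def)

lemma cosine_sym: assumes "s \<in> S" "t \<in> S" shows "cosine s t = cosine t s"
proof -
  have "inv (s \<otimes> t) = t \<otimes> s" using assms by (simp add: inv_mult_group)
  then show ?thesis using assms ord_inv[of "s \<otimes> t"] by (simp add: cosine_def)
qed

lemma coroot_add: "coroot s (u + v) = coroot s u + coroot s v"
  and coroot_scale: "coroot s (c *\<^sub>F v) = c * coroot s v"
  and coroot_diff: "coroot s (u - v) = coroot s u - coroot s v"
  unfolding coroot_def
  by (simp_all add: algebra_simps sum.distrib sum_distrib_left sum_subtractf)

lemma coroot_unit_fun: "t \<in> S \<Longrightarrow> coroot s (unit_fun t) = cosine s t"
  using finite_gens by (simp add: coroot_def unit_fun_def if_distrib cong: if_cong)

lemma reflect_linear: "linear_fun (reflect s)"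
  by (rule linear_funI) (auto simp: reflect_def coroot_add coroot_scale fun_eq_iff algebra_simps)

lemma reflect_refl [simp]: "s \<in> S \<Longrightarrow> reflect s (reflect s v) = v"
  by (auto simp: reflect_def coroot_diff coroot_scale coroot_unit_fun fun_eq_iff algebra_simps)

lemma reflect_unit_same: "s \<in> S \<Longrightarrow> reflect s (unit_fun s) = - unit_fun s"
  by (auto simp: reflect_def coroot_unit_fun fun_eq_iff algebra_simps)

lemma reflect_unit: "t \<in> S \<Longrightarrow> reflect s (unit_fun t) = unit_fun t + (- 2 * cosine s t) *\<^sub>F unit_fun s"
  by (auto simp: reflect_def coroot_unit_fun fun_eq_iff algebra_simps)

text \<open>The representation is defined on words, where no relation has to be respected;
  \<open>act_eqI\<close> shows that it descends to the group.\<close>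

definition act :: "'a list \<Rightarrow> ('a \<Rightarrow> real) \<Rightarrow> 'a \<Rightarrow> real" where
  "act ss = foldr reflect ss"

lemma act_Nil [simp]: "act [] v = v"
  and act_Cons [simp]: "act (s # ss) v = reflect s (act ss v)"
  and act_append [simp]: "act (us @ vs) v = act us (act vs v)"
  by (simp_all add: act_def)

lemma act_linear: "linear_fun (act ss)"
proof (induction ss)
  case Nil
  show ?case by (rule linear_funI) (simp_all only: act_Nil)
next
  case (Cons s ss)
  then show ?case
    using linear_fun_compose[OF reflect_linear] by (simp only: act_Cons[abs_def])
qed

text \<open>The roots of a dihedral subgroup in coordinates. In the induction the last letter
  \<open>t\<close> adds \<open>c\<close> times the root of \<open>t\<close> to the root of
  \<open>s\<close>. The next letter \<open>s\<close> negates the root of \<open>s\<close> and leaves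
  a word two letters shorter, while the other summand is the case of one letter less with
  \<open>s\<close> and \<open>t\<close> exchanged. This is the recursion of
  \<open>chebyshev\<close>.\<close>

lemma act_alternating:
  assumes "s \<in> S" "t \<in> S"
  defines "c \<equiv> - 2 * cosine s t"
  shows "act (alternating k s t) (unit_fun s) =
    chebyshev c (Suc k) *\<^sub>F unit_fun (if even k then s else t) +
    chebyshev c k *\<^sub>F unit_fun (if even k then t else s)"
  using assms(1,2) unfolding c_def
proof (induction k arbitrary: s t rule: induct_nat_012)
  case 0
  then show ?case by (auto simp: fun_eq_iff)
next
  case 1
  then show ?case using cosine_sym[of s t] by (auto simp: reflect_unit fun_eq_iff)
next
  case (ge2 k)
  let ?c = "- 2 * cosine s t"
  have c: "?c = - 2 * cosine t s" using cosine_sym ge2.prems by simp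
  have "act (alternating (Suc (Suc k)) s t) (unit_fun s) =
      act (alternating (Suc k) t s) (unit_fun s + ?c *\<^sub>F unit_fun t)"
    using ge2.prems c by (simp add: reflect_unit)
  also have "\<dots> = act (alternating k s t) (reflect s (unit_fun s)) +
      ?c *\<^sub>F act (alternating (Suc k) t s) (unit_fun t)"
    by (simp only: linear_fun_add[OF act_linear] linear_fun_scale[OF act_linear] alternating.simps
        act_append act_Cons act_Nil)
  also have "\<dots> = - act (alternating k s t) (unit_fun s) +
      ?c *\<^sub>F act (alternating (Suc k) t s) (unit_fun t)"
    using ge2.prems by (simp only: reflect_unit_same linear_fun_neg[OF act_linear])
  also have "\<dots> = chebyshev ?c (Suc (Suc (Suc k))) *\<^sub>F unit_fun (if even k then s else t) +
    chebyshev ?c (Suc (Suc k)) *\<^sub>F unit_fun (if even k then t else s)"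
    unfolding ge2.IH(1)[OF ge2.prems] ge2.IH(2)[OF ge2.prems(2,1)] c[symmetric]
    by (auto simp: fun_eq_iff algebra_simps)
  finally show ?case by simp
qed

lemma ord_gen_mult_ge_2:
  assumes "s \<in> S" "t \<in> S" "s \<noteq> t" shows "ord (s \<otimes> t) = 0 \<or> 2 \<le> ord (s \<otimes> t)"
proof -
  have "s \<otimes> t \<noteq> \<one>" using inv_equality[of s t] assms by auto
  then have "ord (s \<otimes> t) \<noteq> 1" using assms ord_eq_1[of "s \<otimes> t"] by simp
  then show ?thesis by linarith
qed

text \<open>For finite order m the value is sin(k pi / m) / sin(pi / m), and k pi / m stays between
  0 and pi as long as k \<le> m. For infinite order the value is \<open>k\<close>.\<close>

lemma chebyshev_cosine_nonneg:
  assumes "s \<in> S" "t \<in> S" "s \<noteq> t" "ord (s \<otimes> t) = 0 \<or> k \<le> ord (s \<otimes> t)"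
  shows "0 \<le> chebyshev (- 2 * cosine s t) k"
proof (cases "ord (s \<otimes> t) = 0")
  case True
  then show ?thesis by (simp add: cosine_def chebyshev_2)
next
  case False
  define m where "m = ord (s \<otimes> t)"
  have m: "2 \<le> m" using ord_gen_mult_ge_2[OF assms(1-3)] False by (simp add: m_def)
  have "chebyshev (- 2 * cosine s t) k * sin (pi / real m) = sin (real k * (pi / real m))"
    using chebyshev_cos[of "pi / real m" k] by (simp add: cosine_def m_def)
  moreover have "0 \<le> sin (real k * (pi / real m))"
  proof (rule sin_ge_zero)
    have "pi * real k \<le> pi * real m" using assms(4) False
      by (intro mult_left_mono) (auto simp: m_def)
    then show "real k * (pi / real m) \<le> pi" using m by (simp add: divide_le_eq mult.commute)
  qed simp
  ultimately have "0 \<le> chebyshev (- 2 * cosine s t) k * sin (pi / real m)" by simp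
  then show ?thesis using sin_pi_div_pos[OF m] by (simp add: zero_le_mult_iff)
qed

lemma reflect_fixes: "coroot s v = 0 \<Longrightarrow> reflect s v = v"
  by (auto simp: reflect_def fun_eq_iff)

text \<open>For distinct generators the plane of the two roots is fixed because
  \<open>chebyshev\<close> is periodic. The form is nondegenerate on this plane since the order is
  finite, so every vector differs from one in the plane by a vector that both coroots kill, and such
  a vector is fixed by both reflections.\<close>

lemma act_alternating_order:
  assumes st: "s \<in> S" "t \<in> S" and m: "0 < ord (s \<otimes> t)"
  shows "act (alternating (2 * ord (s \<otimes> t)) s t) v = v"
proof (cases "s = t")
  case True
  then have "ord (s \<otimes> t) = 1" using st by simp
  then show ?thesis using True st by (simp add: numeral_2_eq_2)
next
  case False
  let ?m = "ord (s \<otimes> t)"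
  define w where "w = alternating (2 * ?m) s t"
  let ?c = "- 2 * cosine s t"
  have m2: "2 \<le> ?m" using ord_gen_mult_ge_2[OF st False] m by simp
  have c: "?c = 2 * cos (pi / real ?m)" by (simp add: cosine_def)
  note 1 = chebyshev_period(1)[OF m2 c] and 2 = chebyshev_period(2)[OF m2 c]
    and 3 = chebyshev_period(3)[OF m2 c]
  have s: "act w (unit_fun s) = unit_fun s"
    unfolding w_def using act_alternating[OF st, of "2 * ?m"] 1 2 by (auto simp: fun_eq_iff)
  \<comment> \<open>For the root of \<open>t\<close> the last letter only gives a sign and leaves
    \<open>2 * ?m - 1\<close> letters; the value - 1 at this index compensates the sign.\<close>
  define k where "k = 2 * ?m - 1"
  have k: "2 * ?m = Suc k" "odd k" using m by (auto simp: k_def)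
  have "act w (unit_fun t) = act (alternating k t s) (reflect t (unit_fun t))"
    unfolding w_def k(1) by simp
  also have "\<dots> = - act (alternating k t s) (unit_fun t)"
    using st by (simp only: reflect_unit_same linear_fun_neg[OF act_linear])
  also have "\<dots> = unit_fun t"
    using act_alternating[OF st(2,1), of k] 1[unfolded k(1)] 3[folded k_def] k(2) cosine_sym[OF st]
    by (auto simp: fun_eq_iff)
  finally have t: "act w (unit_fun t) = unit_fun t" .
  \<comment> \<open>The Gram determinant of the two roots, equal to the square of sin(pi / ?m);
    \<open>a\<close> and \<open>b\<close> below come from Cramer's rule.\<close>
  define d where "d = 1 - (cosine s t)\<^sup>2"
  have d: "d \<noteq> 0"
  proof -
    have "d = (sin (pi / real ?m))\<^sup>2" by (simp add: d_def cosine_def sin_squared_eq)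
    then show ?thesis using sin_pi_div_pos[OF m2] by simp
  qed
  define f where "f = coroot s v"
  define g where "g = coroot t v"
  define a where "a = (f - cosine s t * g) / d"
  define b where "b = (g - cosine s t * f) / d"
  define v0 where "v0 = v - a *\<^sub>F unit_fun s - b *\<^sub>F unit_fun t"
  have ab: "a + b * cosine s t = f" "a * cosine s t + b = g"
    using d unfolding a_def b_def by (simp_all add: field_simps) (simp_all add: d_def power2_eq_square algebra_simps)
  have "coroot s v0 = 0" "coroot t v0 = 0"
    using ab st cosine_sym[OF st] by (simp_all add: v0_def coroot_diff coroot_scale coroot_unit_fun f_def g_def)
  then have "act (alternating k s t) v0 = v0 \<and> act (alternating k t s) v0 = v0" for k
    by (induction k) (auto simp: reflect_fixes)
  then have v0: "act w v0 = v0" unfolding w_def by blast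
  have v: "v = v0 + a *\<^sub>F unit_fun s + b *\<^sub>F unit_fun t" by (simp add: v0_def)
  have "act w v = act w (v0 + a *\<^sub>F unit_fun s + b *\<^sub>F unit_fun t)"
    by (rule arg_cong[OF v])
  also have "\<dots> = v0 + a *\<^sub>F unit_fun s + b *\<^sub>F unit_fun t"
    by (simp only: linear_fun_add[OF act_linear] linear_fun_scale[OF act_linear] s t v0)
  finally show ?thesis unfolding w_def v[symmetric] .
qed

lemma word_prod_alternating_double:
  assumes "s \<in> S" "t \<in> S"
  shows "word_prod W (alternating (2 * k) s t) = (s \<otimes> t) [^] k"
proof (induction k)
  case (Suc k)
  have "alternating (2 * k) s t \<in> lists S" using assms by (rule alternating_in_lists)
  then show ?case using Suc assms by (simp add: m_assoc)
qed auto

text \<open>A relation gives (s t)^k = 1 in the group, so the order on which \<open>cosine\<close>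
  is based divides \<open>k\<close>, and the relator acts as a power of a word that acts trivially.
  If the order is 0, then \<open>k = 0\<close> and the relator is empty.\<close>

lemma act_cong: assumes "coxeter_cong S m us vs"
  and "\<And>us vs. us \<in> lists S \<Longrightarrow> vs \<in> lists S \<Longrightarrow>
         coxeter_cong S m us vs \<Longrightarrow> word_prod W us = word_prod W vs"
  shows "act us = act vs"
  using assms(1)
proof induction
  case (rel us vs s t k)
  have st: "s \<otimes> t \<in> carrier W" using rel by simp
  have w: "concat (replicate k [s, t]) \<in> lists S"
    using alternating_in_lists[of s S t "2 * k"] rel by (simp add: alternating_double)
  have "coxeter_cong S m ([] @ concat (replicate k [s, t]) @ []) ([] @ [])"
    using rel by (intro coxeter_cong.rel) auto
  then have "word_prod W (concat (replicate k [s, t])) = \<one>"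
    using assms(2)[OF w, of "[]"] by simp
  then have "(s \<otimes> t) [^] k = \<one>"
    using word_prod_alternating_double[of s t k] rel by (simp add: alternating_double)
  then have "ord (s \<otimes> t) dvd k" using pow_eq_id[OF st] by simp
  then obtain j where j: "k = ord (s \<otimes> t) * j" by blast
  have "act (alternating (2 * (ord (s \<otimes> t) * j)) s t) = (\<lambda>v. v)"
  proof (rule ext)
    fix v
    show "act (alternating (2 * (ord (s \<otimes> t) * j)) s t) v = v"
    proof (cases "ord (s \<otimes> t) = 0")
      case False
      show ?thesis
      proof (induction j)
        case (Suc j)
        have "2 * (ord (s \<otimes> t) * Suc j) = 2 * (ord (s \<otimes> t) * j) + 2 * ord (s \<otimes> t)" by simp
        then show ?case
          using Suc act_alternating_order[OF rel(3,4)] False by (simp only: alternating_add) simp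
      qed simp
    qed simp
  qed
  then show ?case unfolding j by (simp add: act_append[abs_def] alternating_double)
qed auto

lemma act_eqI:
  assumes "us \<in> lists S" "vs \<in> lists S" "word_prod W us = word_prod W vs"
  shows "act us = act vs"
proof -
  obtain m where m: "\<forall>us\<in>lists S. \<forall>vs\<in>lists S.
       word_prod W us = word_prod W vs \<longleftrightarrow> coxeter_cong S m us vs"
    by (rule presentation)
  show ?thesis by (rule act_cong[of m]) (use m assms in auto)
qed

section \<open>From words to group elements\<close>

definition rep :: "'a \<Rightarrow> ('a \<Rightarrow> real) \<Rightarrow> 'a \<Rightarrow> real" where
  "rep w = act (SOME ss. ss \<in> lists S \<and> word_prod W ss = w)"

lemma rep_word_prod: assumes "ss \<in> lists S" shows "rep (word_prod W ss) = act ss"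
proof -
  define us where "us = (SOME us. us \<in> lists S \<and> word_prod W us = word_prod W ss)"
  have "us \<in> lists S \<and> word_prod W us = word_prod W ss"
    unfolding us_def by (rule someI[of _ ss]) (use assms in simp)
  then show ?thesis using act_eqI assms unfolding rep_def us_def[symmetric] by blast
qed

lemma rep_mult:
  assumes "x \<in> carrier W" "y \<in> carrier W" shows "rep (x \<otimes> y) v = rep x (rep y v)"
proof -
  obtain us vs where "us \<in> lists S" "word_prod W us = x" "vs \<in> lists S" "word_prod W vs = y"
    using word_exists assms by metis
  then show ?thesis
    using rep_word_prod[of "us @ vs"] rep_word_prod[of us] rep_word_prod[of vs] by simp
qed

lemma rep_one [simp]: "rep \<one> v = v"
  using rep_word_prod[of "[]"] by simp

lemma rep_gen: "s \<in> S \<Longrightarrow> rep s = reflect s"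
  using rep_word_prod[of "[s]"] by (simp add: fun_eq_iff)

lemma rep_linear: "linear_fun (rep w)"
  unfolding rep_def by (rule act_linear)

end

section \<open>Positivity of roots and strong exchange\<close>

lemma alternatingI:
  assumes "a \<in> lists {s, t}" "\<And>p x q. a \<noteq> p @ [x, x] @ q" "a = [] \<or> last a = t"
  shows "a = alternating (length a) s t"
  using assms
proof (induction a arbitrary: s t rule: rev_induct)
  case (snoc y b)
  have y: "y = t" using snoc.prems(3) by simp
  have "b = [] \<or> last b = s"
  proof (rule disjCI)
    assume ne: "last b \<noteq> s"
    show "b = []"
    proof (rule ccontr)
      assume "b \<noteq> []"
      then have b: "b = butlast b @ [last b]" by simp
      moreover have "last b \<in> {s, t}"
        using snoc.prems(1) \<open>b \<noteq> []\<close> by (metis append_in_lists_conv in_lists_conv_set last_in_set)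
      ultimately have "b @ [y] = butlast b @ [t, t] @ []"
        using ne y by (metis append.assoc append_Cons append_Nil insertE singletonD)
      then show False using snoc.prems(2) by blast
    qed
  qed
  moreover have "b \<in> lists {t, s}" using snoc.prems(1) by (simp add: insert_commute)
  moreover have "b \<noteq> p @ [x, x] @ q" for p x q using snoc.prems(2)[of p x "q @ [y]"] by auto
  ultimately have "b = alternating (length b) t s" by (intro snoc.IH)
  then show ?case using y by simp
qed simp

context coxeter_group
begin

lemma word_prod_square_cancel:
  assumes "p \<in> lists S" "x \<in> S" "q \<in> lists S"
  shows "word_prod W (p @ [x, x] @ q) = word_prod W (p @ q)"
  using assms by simp

text \<open>The alternating word of twice this length represents the identity. Its left half is
  therefore inverse to its right half, and reversing the left half, which inverts it, gives the
  other alternating word.\<close>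

lemma word_prod_braid:
  assumes "s \<in> S" "t \<in> S"
  shows "word_prod W (alternating (ord (s \<otimes> t)) s t) = word_prod W (alternating (ord (s \<otimes> t)) t s)"
proof -
  let ?m = "ord (s \<otimes> t)"
  let ?u = "if even ?m then alternating ?m s t else alternating ?m t s"
  have l: "alternating k s t \<in> lists S" "alternating k t s \<in> lists S" for k
    using assms alternating_in_lists by metis+
  have "word_prod W (?u @ alternating ?m s t) = \<one>"
    using word_prod_alternating_double[OF assms, of ?m] alternating_add[of ?m ?m s t] assms
    by (simp add: mult_2)
  then have "word_prod W ?u \<otimes> word_prod W (alternating ?m s t) = \<one>"
    using l by (simp split: if_splits)
  then have "word_prod W (alternating ?m s t) = inv (word_prod W ?u)"
    using l by (intro inv_equality[symmetric] inv_comm[of "word_prod W ?u"]) auto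
  also have "\<dots> = word_prod W (rev ?u)" using l by (simp add: word_prod_rev)
  also have "rev ?u = alternating ?m t s" by (simp add: rev_alternating)
  finally show ?thesis .
qed

lemma rep_mult_gen_unit:
  assumes "w \<in> carrier W" "s \<in> S" shows "rep (w \<otimes> s) (unit_fun s) = - rep w (unit_fun s)"
  using assms linear_fun_neg[OF rep_linear] by (simp add: rep_mult rep_gen reflect_unit_same)

text \<open>
  With \<open>t\<close> a right descent of \<open>w\<close>, a factorisation \<open>w = v a\<close> with additive lengths and \<open>a\<close> a longest
  possible word in \<open>s\<close> and \<open>t\<close> reduces the claim to \<open>v\<close> and to the dihedral formula for \<open>a\<close>.
\<close>
lemma rep_unit_nonneg:
  assumes "w \<in> carrier W" "s \<in> S" "len w < len (w \<otimes> s)"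
  shows "0 \<le> rep w (unit_fun s)"
  using assms
proof (induction "len w" arbitrary: w s rule: less_induct)
  case less
  note w = less.prems(1) and s = less.prems(2)
  show ?case
  proof (cases "w = \<one>")
    case True
    then show ?thesis by (simp add: le_fun_def unit_fun_apply)
  next
    case False
    then obtain t where t: "t \<in> S" "len (w \<otimes> t) < len w" using right_descent_exists w by blast
    have st: "s \<noteq> t" using t less.prems by auto
    \<comment> \<open>\<open>P n\<close> says that \<open>n\<close> letters from \<open>s\<close>
      and \<open>t\<close> can be split off at the right with additive lengths. The bound
      \<open>len w\<close> makes a largest \<open>n\<close> exist, and its maximality forces both
      generators to be ascents of the remaining \<open>v\<close>.\<close>
    define P where "P = (\<lambda>n. \<exists>v a. length a = n \<and> v \<in> carrier W \<and> a \<in> lists {s, t} \<and>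
       w = v \<otimes> word_prod W a \<and> len w = len v + length a)"
    have ex: "P 1"
      unfolding P_def
      by (rule exI[of _ "w \<otimes> t"], rule exI[of _ "[t]"]) (use t w len_mult_gen[of t w] in auto)
    have bound: "n \<le> len w" if "P n" for n using that unfolding P_def by auto
    define n where "n = Greatest P"
    have "P n" unfolding n_def using ex bound by (rule GreatestI_nat)
    have max: "k \<le> n" if "P k" for k unfolding n_def using that bound by (rule Greatest_le_nat)
    have n1: "1 \<le> n" using max ex by blast
    obtain v a where va: "length a = n" "v \<in> carrier W" "a \<in> lists {s, t}"
      "w = v \<otimes> word_prod W a" "len w = len v + length a"
      using \<open>P n\<close> unfolding P_def by blast
    have lS: "b \<in> lists S" if "b \<in> lists {s, t}" for b
      using lists_mono[of "{s, t}" S] that s t(1) by blast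
    note aS = lS[OF va(3)]
    have up: "len v < len (v \<otimes> r)" if r: "r \<in> {s, t}" for r
    proof (rule ccontr)
      assume not: "\<not> ?thesis"
      have rS: "r \<in> S" using r s t by auto
      have "P (Suc n)"
        unfolding P_def
      proof (intro exI conjI)
        show "length (r # a) = Suc n" using va by simp
        show "v \<otimes> r \<in> carrier W" using va rS by simp
        show "r # a \<in> lists {s, t}" using va r by simp
        show "w = (v \<otimes> r) \<otimes> word_prod W (r # a)" using va rS aS by (simp add: m_assoc)
        show "len w = len (v \<otimes> r) + length (r # a)"
          using len_mult_gen[OF rS va(2)] not va by auto
      qed
      then show False using max by fastforce
    qed
    have nonneg: "0 \<le> rep v (unit_fun s)" "0 \<le> rep v (unit_fun t)"
      using less.hyps[of v] va n1 up s t by auto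
    have short: "len w \<le> len v + length b" if "b \<in> lists {s, t}" "word_prod W b = word_prod W a" for b
      using len_mult_le[of v "word_prod W b"] len_le[OF lS[OF that(1)]] va that aS by simp
    \<comment> \<open>A word for the suffix that ends in \<open>s\<close> and is no longer than
      \<open>a\<close> would cancel against the new factor \<open>s\<close> and contradict
      \<open>len w < len (w \<otimes> s)\<close>.\<close>
    have not_s: "word_prod W a \<noteq> word_prod W (b @ [s])"
      if "b \<in> lists {s, t}" "length b < length a" for b
    proof
      assume "word_prod W a = word_prod W (b @ [s])"
      then have "w \<otimes> s = v \<otimes> word_prod W b" using va s lS[OF that(1)] by (simp add: m_assoc)
      then have "len (w \<otimes> s) \<le> len v + length b"
        using len_mult_le[of v "word_prod W b"] len_le[OF lS[OF that(1)]] va lS[OF that(1)] by simp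
      then show False using less.prems(3) va that by simp
    qed
    have last: "last a = t"
    proof (rule ccontr)
      assume ne: "last a \<noteq> t"
      have "a \<noteq> []" using va n1 by auto
      then have a: "a = butlast a @ [last a]" by simp
      then have b: "butlast a \<in> lists {s, t}" "last a \<in> {s, t}"
        using va(3) by (metis append_in_lists_conv, metis append_in_lists_conv Cons_in_lists_iff)
      then have "a = butlast a @ [s]" using a ne by auto
      then show False using not_s[OF b(1)] \<open>a \<noteq> []\<close> by (metis length_append_singleton lessI)
    qed
    have alt: "a = alternating n s t"
    proof -
      have "a \<noteq> p @ [x, x] @ q" for p x q
      proof
        assume a: "a = p @ [x, x] @ q"
        then have "p @ q \<in> lists {s, t}" using va(3) by simp
        moreover have "word_prod W (p @ q) = word_prod W a"
          using a aS word_prod_square_cancel[of p x q] by auto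
        ultimately have "len w \<le> len v + length (p @ q)" by (rule short)
        then show False using va a by simp
      qed
      then show ?thesis using alternatingI[OF va(3)] last va(1) by metis
    qed
    \<comment> \<open>If the order is finite and \<open>a\<close> is at least that long, the braid
      relation applied to its last letters makes it end in \<open>s\<close>, which
      \<open>not_s\<close> forbids. The bound keeps both coefficients below nonnegative.\<close>
    have n: "ord (s \<otimes> t) = 0 \<or> Suc n \<le> ord (s \<otimes> t)"
    proof (rule ccontr)
      let ?m = "ord (s \<otimes> t)"
      assume "\<not> ?thesis"
      then have m: "0 < ?m" "?m \<le> n" by auto
      define b where "b = (if even ?m then alternating (n - ?m) s t else alternating (n - ?m) t s)"
      have bl: "b \<in> lists {s, t}" by (auto simp: b_def intro!: alternating_in_lists)
      have al: "alternating k s t \<in> lists {s, t}" "alternating k t s \<in> lists {s, t}" for k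
        by (auto intro!: alternating_in_lists)
      have "a = b @ alternating ?m s t"
        using alternating_add[of "n - ?m" ?m s t] m alt by (simp add: b_def)
      then have "word_prod W a = word_prod W (b @ alternating ?m t s)"
        using word_prod_braid[OF s t(1)] lS[OF bl] lS[OF al(1)] lS[OF al(2)] by simp
      also obtain k where k: "?m = Suc k" using m by (cases ?m) auto
      have "b @ alternating ?m t s = (b @ alternating k s t) @ [s]" unfolding k by simp
      finally have "word_prod W a = word_prod W ((b @ alternating k s t) @ [s])" .
      moreover have "b @ alternating k s t \<in> lists {s, t}" using bl al by simp
      moreover have "length (b @ alternating k s t) < length a"
        using m k va(1) by (simp add: b_def)
      ultimately show False using not_s by blast
    qed
    let ?c = "- 2 * cosine s t"
    have c: "0 \<le> chebyshev ?c (Suc n)" "0 \<le> chebyshev ?c n"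
      using chebyshev_cosine_nonneg[OF s t(1) st, of "Suc n"]
        chebyshev_cosine_nonneg[OF s t(1) st, of n] n by auto
    have "rep w (unit_fun s) = rep v (act a (unit_fun s))"
      using va aS by (simp add: rep_mult rep_word_prod)
    also have "\<dots> = chebyshev ?c (Suc n) *\<^sub>F rep v (unit_fun (if even n then s else t)) +
        chebyshev ?c n *\<^sub>F rep v (unit_fun (if even n then t else s))"
      unfolding alt act_alternating[OF s t(1)]
      by (simp only: linear_fun_add[OF rep_linear] linear_fun_scale[OF rep_linear])
    finally show ?thesis using nonneg c by (auto simp: le_fun_def)
  qed
qed

lemma rep_unit_nonpos:
  assumes "w \<in> carrier W" "s \<in> S" "len (w \<otimes> s) < len w"
  shows "rep w (unit_fun s) \<le> 0"
proof -
  have "0 \<le> rep (w \<otimes> s) (unit_fun s)" using assms by (intro rep_unit_nonneg) auto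
  then show ?thesis using rep_mult_gen_unit assms by (auto simp: le_fun_def)
qed

lemma rep_eq_zeroD: assumes "w \<in> carrier W" "rep w v = 0" shows "v = 0"
proof -
  have "rep (inv w) (rep w v) = v" using assms rep_mult[of "inv w" w v] by simp
  then show ?thesis using assms linear_fun_zero[OF rep_linear] by simp
qed

lemma unit_fun_neq_0: "unit_fun s \<noteq> 0"
  by (metis unit_fun_apply zero_fun_apply zero_neq_one)

text \<open>A nontrivial element has a right descent \<open>s\<close> and sends the simple root of
  \<open>s\<close> to a negative vector, which the identity does not.\<close>

lemma rep_faithful:
  assumes "x \<in> carrier W" "y \<in> carrier W" "rep x = rep y" shows "x = y"
proof (rule ccontr)
  assume ne: "x \<noteq> y"
  define w where "w = inv y \<otimes> x"
  have w: "w \<in> carrier W" using assms by (simp add: w_def)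
  have "w \<noteq> \<one>" using ne assms unfolding w_def by (metis inv_closed inv_equality inv_inv)
  then obtain s where s: "s \<in> S" "len (w \<otimes> s) < len w" using right_descent_exists w by blast
  have "rep w v = v" for v
    using assms rep_mult[of "inv y" y v] by (simp add: w_def rep_mult)
  then have "unit_fun s \<le> 0" using rep_unit_nonpos[OF w s] by simp
  then have "unit_fun s s \<le> 0" by (simp add: le_fun_def)
  then show False by (simp add: unit_fun_apply)
qed

section \<open>The invariant form, reflections and their roots\<close>

definition form :: "('a \<Rightarrow> real) \<Rightarrow> ('a \<Rightarrow> real) \<Rightarrow> real" where
  "form u v = (\<Sum>s\<in>S. u s * coroot s v)"

lemma form_diff_left: "form (u - v) w = form u w - form v w"
  and form_scale_left: "form (c *\<^sub>F u) w = c * form u w"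
  and form_diff_right: "form w (u - v) = form w u - form w v"
  and form_scale_right: "form w (c *\<^sub>F u) = c * form w u"
  unfolding form_def
  by (simp_all add: algebra_simps sum.distrib sum_distrib_left sum_subtractf coroot_diff coroot_scale)

lemma form_unit_left: "s \<in> S \<Longrightarrow> form (unit_fun s) v = coroot s v"
  using finite_gens by (simp add: form_def unit_fun_def if_distrib[of "\<lambda>x. x * _"] cong: if_cong)

lemma form_sym: "form u v = form v u"
proof -
  have "form u v = (\<Sum>s\<in>S. \<Sum>t\<in>S. u s * cosine s t * v t)"
    by (simp add: form_def coroot_def sum_distrib_left algebra_simps)
  also have "\<dots> = (\<Sum>t\<in>S. \<Sum>s\<in>S. u s * cosine s t * v t)" by (rule sum.swap)
  also have "\<dots> = (\<Sum>t\<in>S. \<Sum>s\<in>S. v t * (cosine t s * u s))"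
  proof (rule sum.cong[OF HOL.refl], rule sum.cong[OF HOL.refl])
    fix s t assume "s \<in> S" "t \<in> S"
    then have "cosine s t = cosine t s" by (rule cosine_sym)
    then show "u s * cosine s t * v t = v t * (cosine t s * u s)" by simp
  qed
  also have "\<dots> = form v u" by (simp add: form_def coroot_def sum_distrib_left)
  finally show ?thesis .
qed

lemma form_reflect: assumes "s \<in> S" shows "form (reflect s u) (reflect s v) = form u v"
proof -
  have r: "form w (unit_fun s) = coroot s w" for w
    by (subst form_sym) (rule form_unit_left[OF assms])
  show ?thesis
    unfolding reflect_def form_diff_left form_diff_right form_scale_left form_scale_right
      form_unit_left[OF assms] r coroot_diff coroot_scale coroot_unit_fun[OF assms]
      cosine_same[OF assms]
    by (simp add: algebra_simps)
qed

lemma form_rep: assumes "w \<in> carrier W" shows "form (rep w u) (rep w v) = form u v"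
proof -
  obtain ss where ss: "ss \<in> lists S" "word_prod W ss = w" using word_exists assms by blast
  have "form (act ss u) (act ss v) = form u v"
    using ss(1) by (induction ss) (auto simp: form_reflect)
  then show ?thesis using rep_word_prod[OF ss(1)] ss(2) by simp
qed

lemma rep_conj_gen:
  assumes "w \<in> carrier W" "s \<in> S"
  shows "rep (w \<otimes> s \<otimes> inv w) v = v - (2 * form (rep w (unit_fun s)) v) *\<^sub>F rep w (unit_fun s)"
proof -
  have v: "rep w (rep (inv w) v) = v" using assms rep_mult[of w "inv w" v] by simp
  have "rep (w \<otimes> s \<otimes> inv w) v = rep w (reflect s (rep (inv w) v))"
    using assms by (simp add: rep_mult rep_gen)
  also have "\<dots> = v - (2 * coroot s (rep (inv w) v)) *\<^sub>F rep w (unit_fun s)"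
    unfolding reflect_def by (simp only: linear_fun_diff[OF rep_linear] linear_fun_scale[OF rep_linear] v)
  also have "coroot s (rep (inv w) v) = form (rep w (unit_fun s)) v"
    using form_rep[OF assms(1), of "unit_fun s" "rep (inv w) v"] assms by (simp add: v form_unit_left)
  finally show ?thesis .
qed

text \<open>By \<open>rep_conj_gen\<close> both conjugates act as the reflection in the common root,
  so faithfulness identifies them.\<close>

lemma conj_gen_eqI:
  assumes "x \<in> carrier W" "y \<in> carrier W" "s \<in> S" "t \<in> S"
    and "rep x (unit_fun s) = rep y (unit_fun t)"
  shows "x \<otimes> s \<otimes> inv x = y \<otimes> t \<otimes> inv y"
proof (rule rep_faithful)
  show "rep (x \<otimes> s \<otimes> inv x) = rep (y \<otimes> t \<otimes> inv y)"
    by (rule ext) (simp only: rep_conj_gen[OF assms(1,3)] rep_conj_gen[OF assms(2,4)] assms(5))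
qed (use assms(1-4) in simp_all)

lemma conj_gen_square:
  assumes "x \<in> carrier W" "s \<in> S" shows "(x \<otimes> s \<otimes> inv x) \<otimes> (x \<otimes> s \<otimes> inv x) = \<one>"
proof -
  have "inv x \<otimes> (x \<otimes> (s \<otimes> inv x)) = s \<otimes> inv x"
    using assms by (simp add: m_assoc[symmetric] del: gen_cancel)
  then show ?thesis using assms by (simp add: m_assoc)
qed

text \<open>\<open>reflect s\<close> touches only the coordinate \<open>s\<close>, so a sign change
  leaves no other nonzero coordinate. The invariant form gives the root norm 1, which fixes the
  multiple of the simple root.\<close>

lemma root_sign_change:
  assumes x: "x \<in> carrier W" and s: "s \<in> S" and r: "r \<in> S"
    and pos: "0 \<le> rep x (unit_fun r)" and neg: "reflect s (rep x (unit_fun r)) \<le> 0"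
  shows "rep x (unit_fun r) = unit_fun s"
proof -
  define v where "v = rep x (unit_fun r)"
  have "v y = 0" if "y \<noteq> s" for y
  proof -
    have "reflect s v y = v y" using that by (simp add: reflect_def unit_fun_apply)
    moreover have "0 \<le> v y" "reflect s v y \<le> 0" using pos neg by (auto simp: v_def le_fun_def)
    ultimately show ?thesis by simp
  qed
  then have v: "v = v s *\<^sub>F unit_fun s" by (intro ext) (simp add: unit_fun_apply)
  obtain c where c: "v = c *\<^sub>F unit_fun s" "c = v s" using v by blast
  have "form v v = 1"
    using form_rep[OF x, of "unit_fun r" "unit_fun r"] r by (simp add: v_def form_unit_left coroot_unit_fun)
  moreover have "form v v = c * c"
    unfolding c(1) using s by (simp add: form_scale_left form_scale_right form_unit_left coroot_unit_fun)
  moreover have "0 \<le> c" using pos unfolding c(2) by (simp add: v_def le_fun_def)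
  ultimately have "c = 1" by (simp add: square_eq_1_iff)
  then show ?thesis using c(1) unfolding v_def[symmetric] by (simp add: scale_fun_def)
qed

definition reflections :: "'a set" where
  "reflections = {x \<otimes> s \<otimes> inv x | x s. x \<in> carrier W \<and> s \<in> S}"

lemma root_cases:
  assumes "w \<in> carrier W" "s \<in> S"
  shows "0 \<le> rep w (unit_fun s) \<or> rep w (unit_fun s) \<le> 0"
proof (cases "len w < len (w \<otimes> s)")
  case True
  then show ?thesis using rep_unit_nonneg[OF assms] by blast
next
  case False
  then have "len (w \<otimes> s) < len w" using len_mult_gen[OF assms(2,1)] by linarith
  then show ?thesis using rep_unit_nonpos[OF assms] by blast
qed

lemma root_not_both:
  assumes "x \<in> carrier W" "0 \<le> rep x (unit_fun s)" "rep x (unit_fun s) \<le> 0" shows False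
proof -
  have "rep x (unit_fun s) = 0" by (rule order_antisym[OF assms(3,2)])
  from rep_eq_zeroD[OF assms(1) this] show False using unit_fun_neq_0 by (rule notE[rotated])
qed

text \<open>As the letters act from the right end, the positive root becomes negative at some letter
  \<open>s\<close>. Just before, it is the simple root of \<open>s\<close>, so the reflection
  conjugated by the letters already applied is \<open>s\<close>; multiplying by the reflection thus
  deletes this letter.\<close>

lemma exchange_root:
  assumes "ss \<in> lists S" "x \<in> carrier W" "r \<in> S"
    and "0 \<le> rep x (unit_fun r)" "act ss (rep x (unit_fun r)) \<le> 0"
  shows "\<exists>us s vs. ss = us @ s # vs \<and>
    word_prod W (us @ vs) = word_prod W ss \<otimes> (x \<otimes> r \<otimes> inv x)"
  using assms(1,5)
proof (induction ss)
  case Nil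
  then have "rep x (unit_fun r) \<le> 0" by (simp only: act_Nil)
  from root_not_both[OF assms(2,4) this] show ?case ..
next
  case (Cons s ss)
  then have s: "s \<in> S" and ss: "ss \<in> lists S" by auto
  define w where "w = word_prod W ss"
  have w: "w \<in> carrier W" using ss by (simp add: w_def)
  define t where "t = x \<otimes> r \<otimes> inv x"
  have t: "t \<in> carrier W" using assms by (simp add: t_def)
  have wx: "w \<otimes> x \<in> carrier W" using w assms by simp
  have act: "act ss (rep x (unit_fun r)) = rep (w \<otimes> x) (unit_fun r)"
    unfolding rep_mult[OF w assms(2)] unfolding w_def rep_word_prod[OF ss] ..
  show ?case
  proof (cases "act ss (rep x (unit_fun r)) \<le> 0")
    case True
    obtain us s' vs where h: "ss = us @ s' # vs"
      "word_prod W (us @ vs) = word_prod W ss \<otimes> (x \<otimes> r \<otimes> inv x)"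
      using Cons.IH[OF True] by blast
    then have "word_prod W ((s # us) @ vs) = word_prod W (s # ss) \<otimes> t"
      using s w t by (simp add: m_assoc w_def t_def)
    then show ?thesis using h(1) unfolding t_def by (metis append_Cons)
  next
    case False
    then have pos: "0 \<le> rep (w \<otimes> x) (unit_fun r)"
      using root_cases[OF wx assms(3)] unfolding act by blast
    have neg: "reflect s (rep (w \<otimes> x) (unit_fun r)) \<le> 0"
      using Cons.prems unfolding act_Cons act .
    have "rep (w \<otimes> x) (unit_fun r) = rep \<one> (unit_fun s)"
      unfolding rep_one by (rule root_sign_change[OF wx s assms(3) pos neg])
    from conj_gen_eqI[OF wx one_closed assms(3) s this]
    have e: "w \<otimes> t \<otimes> inv w = s"
      using w s assms by (simp add: inv_mult_group m_assoc t_def)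
    have "s \<otimes> w = w \<otimes> t" unfolding e[symmetric] using w t by (simp add: m_assoc)
    then have "s \<otimes> w \<otimes> t = w \<otimes> (t \<otimes> t)" using w t by (simp add: m_assoc)
    also have "\<dots> = w" using conj_gen_square[OF assms(2,3)] w by (simp add: t_def)
    finally have "word_prod W ([] @ ss) = word_prod W (s # ss) \<otimes> t"
      by (simp add: w_def)
    then show ?thesis unfolding t_def by blast
  qed
qed

text \<open>\<open>x\<close> and \<open>x \<otimes> s\<close> yield the same conjugate of
  \<open>s\<close> with opposite roots, one of which is positive.\<close>

lemma reflectionE:
  assumes "t \<in> reflections"
  obtains x s where "x \<in> carrier W" "s \<in> S" "t = x \<otimes> s \<otimes> inv x" "0 \<le> rep x (unit_fun s)"
proof -
  obtain x s where x: "x \<in> carrier W" "s \<in> S" "t = x \<otimes> s \<otimes> inv x"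
    using assms unfolding reflections_def by blast
  show thesis
  proof (cases "0 \<le> rep x (unit_fun s)")
    case True
    show ?thesis by (rule that[OF x True])
  next
    case False
    then have "rep x (unit_fun s) \<le> 0" using root_cases[OF x(1,2)] by blast
    then have nonneg: "0 \<le> rep (x \<otimes> s) (unit_fun s)"
      by (simp only: rep_mult_gen_unit[OF x(1,2)] neg_0_le_iff_le)
    have "t = (x \<otimes> s) \<otimes> s \<otimes> inv (x \<otimes> s)" using x by (simp add: inv_mult_group m_assoc)
    from that[OF _ x(2) this nonneg] show ?thesis using x by simp
  qed
qed

lemma reflection_closed [simp, intro]:
  "t \<in> reflections \<Longrightarrow> t \<in> carrier W"
  unfolding reflections_def by auto

lemma reflection_square: "t \<in> reflections \<Longrightarrow> t \<otimes> t = \<one>"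
  by (elim reflectionE) (simp only: conj_gen_square)

lemma reflection_cancel [simp]: "t \<in> reflections \<Longrightarrow> x \<in> carrier W \<Longrightarrow> x \<otimes> t \<otimes> t = x"
  by (simp add: m_assoc reflection_square)

lemma gen_in_reflections [simp]: "s \<in> S \<Longrightarrow> s \<in> reflections"
  unfolding reflections_def by (rule CollectI, rule exI[of _ \<one>], rule exI[of _ s]) simp

lemma reflection_conj:
  assumes "t \<in> reflections" "y \<in> carrier W" shows "y \<otimes> t \<otimes> inv y \<in> reflections"
proof -
  obtain x s where x: "x \<in> carrier W" "s \<in> S" "t = x \<otimes> s \<otimes> inv x"
    using assms unfolding reflections_def by blast
  then have "y \<otimes> t \<otimes> inv y = (y \<otimes> x) \<otimes> s \<otimes> inv (y \<otimes> x)"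
    using assms by (simp add: m_assoc inv_mult_group)
  then show ?thesis using x assms unfolding reflections_def by blast
qed

text \<open>The point is that the product \<open>w\<close> of \<open>ss\<close> makes the positive
  root of \<open>t\<close> negative. Otherwise \<open>w \<otimes> t\<close> does so, since
  \<open>t\<close> negates its own root; deleting a letter from a reduced word of
  \<open>w \<otimes> t\<close> then produces \<open>w\<close> with too few letters.\<close>

theorem strong_exchange:
  assumes "ss \<in> lists S" "t \<in> reflections" "len (word_prod W ss \<otimes> t) < len (word_prod W ss)"
  obtains us s vs where "ss = us @ s # vs" "word_prod W (us @ vs) = word_prod W ss \<otimes> t"
proof -
  define w where "w = word_prod W ss"
  obtain x r where x: "x \<in> carrier W" "r \<in> S" "t = x \<otimes> r \<otimes> inv x" "0 \<le> rep x (unit_fun r)"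
    by (rule reflectionE[OF assms(2)])
  have w: "w \<in> carrier W" using assms by (simp add: w_def)
  have "rep (w \<otimes> x) (unit_fun r) \<le> 0"
  proof (rule ccontr)
    assume "\<not> ?thesis"
    then have pos: "0 \<le> rep (w \<otimes> x) (unit_fun r)"
      using root_cases[OF m_closed[OF w x(1)] x(2)] by blast
    obtain us where us: "us \<in> lists S" "word_prod W us = w \<otimes> t" "length us = len (w \<otimes> t)"
      using reduced_exists[of "w \<otimes> t"] w assms unfolding reduced_expression_def by auto
    have "act us (rep x (unit_fun r)) = rep (w \<otimes> t \<otimes> x) (unit_fun r)"
      unfolding rep_word_prod[OF us(1), symmetric] us(2)
      by (rule rep_mult[symmetric]) (use w x assms in simp_all)
    also have "w \<otimes> t \<otimes> x = w \<otimes> x \<otimes> r" using w x by (simp add: m_assoc)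
    also have "rep (w \<otimes> x \<otimes> r) (unit_fun r) = - rep (w \<otimes> x) (unit_fun r)"
      using w x by (intro rep_mult_gen_unit) simp_all
    finally have "act us (rep x (unit_fun r)) \<le> 0" using pos by (simp only: neg_le_0_iff_le)
    from exchange_root[OF us(1) x(1,2,4) this, folded x(3)] obtain ps s qs where
      e: "us = ps @ s # qs" "word_prod W (ps @ qs) = word_prod W us \<otimes> t"
      by blast
    then have "word_prod W (ps @ qs) = w" using us w assms by simp
    then have "len w \<le> length (ps @ qs)" using len_le[of "ps @ qs"] us(1) e(1) by auto
    then show False using us(3) assms(3) unfolding e(1) w_def by simp
  qed
  then have "act ss (rep x (unit_fun r)) \<le> 0"
    unfolding rep_mult[OF w x(1)] unfolding w_def rep_word_prod[OF assms(1)] .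
  from exchange_root[OF assms(1) x(1,2,4) this, folded x(3)] show thesis using that by blast
qed

end

section \<open>Bruhat order\<close>

lemma subseq_in_lists: "subseq ts ss \<Longrightarrow> ss \<in> lists A \<Longrightarrow> ts \<in> lists A"
  by (auto simp: in_lists_conv_set dest: list_emb_set)

lemma subseq_rev: "subseq xs ys \<Longrightarrow> subseq (rev xs) (rev ys)"
  by (induction rule: list_emb.induct) (auto intro: list_emb_append_mono)

lemma subseq_delete: "subseq (us @ vs) (us @ x # vs)"
  by (induction us) auto

section \<open>Chains of reflections and the subword property\<close>

context coxeter_group
begin

text \<open>The edges of the Bruhat graph. Paths are transitive by construction, whereas the order
  given by reduced subexpressions is not visibly so; \<open>bruhat_le_iff_chain\<close> identifies
  the two.\<close>

definition bruhat_step :: "'a \<Rightarrow> 'a \<Rightarrow> bool" where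
  "bruhat_step u w \<longleftrightarrow> u \<in> carrier W \<and> (\<exists>t\<in>reflections. w = u \<otimes> t) \<and> len u < len w"

abbreviation bruhat_chain :: "'a \<Rightarrow> 'a \<Rightarrow> bool" where
  "bruhat_chain \<equiv> bruhat_step\<^sup>*\<^sup>*"

definition reduced :: "'a list \<Rightarrow> bool" where
  "reduced ss \<longleftrightarrow> ss \<in> lists S \<and> len (word_prod W ss) = length ss"

lemma reduced_expression_iff: "reduced_expression W S w ss \<longleftrightarrow> reduced ss \<and> word_prod W ss = w"
  by (auto simp: reduced_expression_def reduced_def)

lemma reduced_ConsD: "reduced (s # ss) \<Longrightarrow> reduced ss"
  unfolding reduced_def using len_gen_mult[of s "word_prod W ss"] len_le[of ss] by auto

lemma reduced_Cons_iff:
  "reduced (s # ss) \<longleftrightarrow>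
     s \<in> S \<and> reduced ss \<and> len (word_prod W ss) < len (s \<otimes> word_prod W ss)"
proof
  assume r: "reduced (s # ss)"
  then have "reduced ss" by (rule reduced_ConsD)
  then show "s \<in> S \<and> reduced ss \<and> len (word_prod W ss) < len (s \<otimes> word_prod W ss)"
    using r by (simp add: reduced_def)
next
  assume r: "s \<in> S \<and> reduced ss \<and> len (word_prod W ss) < len (s \<otimes> word_prod W ss)"
  then show "reduced (s # ss)"
    using len_gen_mult[of s "word_prod W ss"] by (auto simp: reduced_def)
qed

lemma left_exchange:
  assumes "ss \<in> lists S" "s \<in> S" "len (s \<otimes> word_prod W ss) < len (word_prod W ss)"
  obtains us x vs where "ss = us @ x # vs" "word_prod W (us @ vs) = s \<otimes> word_prod W ss"
proof -
  define w where "w = word_prod W ss"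
  have w: "w \<in> carrier W" using assms by (simp add: w_def)
  have rev: "rev ss \<in> lists S" using assms by simp
  have rw: "word_prod W (rev ss) = inv w" using assms by (simp add: w_def word_prod_rev)
  have sw: "inv w \<otimes> s = inv (s \<otimes> w)" using w assms by (simp add: inv_mult_group)
  have "len (word_prod W (rev ss) \<otimes> s) < len (word_prod W (rev ss))"
    unfolding rw sw using assms w by (simp add: len_inv w_def[symmetric])
  then obtain us x vs where e: "rev ss = us @ x # vs"
    "word_prod W (us @ vs) = word_prod W (rev ss) \<otimes> s"
    using strong_exchange[OF rev gen_in_reflections[OF assms(2)]] by blast
  have l: "us @ vs \<in> lists S" using rev e(1) by simp
  have "ss = rev vs @ x # rev us" using e(1) by (metis append.assoc append_Cons append_Nil rev.simps(2) rev_append rev_rev_ident)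
  moreover have "word_prod W (rev vs @ rev us) = s \<otimes> word_prod W ss"
    using word_prod_rev[OF l] e(2) rw sw assms w by (simp add: w_def)
  ultimately show thesis by (rule that)
qed

text \<open>The deletion property: reading from the right, a letter that would lower the length is
  dropped together with the letter that \<open>left_exchange\<close> removes.\<close>

lemma reduced_subword:
  assumes "ss \<in> lists S"
  obtains ts where "subseq ts ss" "reduced ts" "word_prod W ts = word_prod W ss"
proof -
  have "\<exists>ts. subseq ts ss \<and> reduced ts \<and> word_prod W ts = word_prod W ss"
    using assms
  proof induction
    case Nil
    show ?case by (rule exI[of _ "[]"]) (simp add: reduced_def)
  next
    case (Cons s ss)
    then obtain ts where ts: "subseq ts ss" "reduced ts" "word_prod W ts = word_prod W ss" by blast
    have tl: "ts \<in> lists S" using ts(2) by (simp add: reduced_def)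
    show ?case
    proof (cases "reduced (s # ts)")
      case True
      then show ?thesis using ts by (intro exI[of _ "s # ts"]) simp
    next
      case False
      then have l: "len (s \<otimes> word_prod W ts) < len (word_prod W ts)"
        using reduced_Cons_iff[of s ts] ts(2) Cons(1) len_gen_mult[of s "word_prod W ts"] tl by auto
      then obtain us x vs where e: "ts = us @ x # vs" "word_prod W (us @ vs) = s \<otimes> word_prod W ts"
        by (rule left_exchange[OF tl Cons(1)])
      have "subseq (us @ vs) ts" unfolding e(1) by (rule subseq_delete)
      then have "subseq (us @ vs) (s # ss)" using ts(1) by (meson subseq_order.order_trans list_emb_Cons)
      moreover have "reduced (us @ vs)"
        using len_gen_mult[OF Cons(1), of "word_prod W ts"] ts(2) tl l e by (auto simp: reduced_def)
      ultimately show ?thesis using e(2) ts(3) by (intro exI[of _ "us @ vs"]) simp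
    qed
  qed
  then show thesis using that by blast
qed

lemma bruhat_step_closed: "bruhat_step u w \<Longrightarrow> u \<in> carrier W \<and> w \<in> carrier W"
  by (auto simp only: bruhat_step_def intro: m_closed reflection_closed)

lemma bruhat_chain_closed: "bruhat_chain u w \<Longrightarrow> w \<in> carrier W \<Longrightarrow> u \<in> carrier W"
  by (induction rule: converse_rtranclp_induct) (auto dest: bruhat_step_closed)

lemma bruhat_chain_len: "bruhat_chain u w \<Longrightarrow> u = w \<or> len u < len w"
  by (induction rule: rtranclp_induct) (auto simp: bruhat_step_def)

text \<open>Each downward step deletes one letter by strong exchange. A deletion can leave a
  nonreduced word, hence the formulation for arbitrary words; \<open>reduced_subword\<close> repairs
  this afterwards.\<close>

lemma chain_imp_subword:
  assumes "bruhat_chain v w" "ss \<in> lists S" "word_prod W ss = w"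
  shows "\<exists>ts. subseq ts ss \<and> word_prod W ts = v"
  using assms
proof (induction arbitrary: ss rule: rtranclp_induct)
  case base
  then show ?case by blast
next
  case (step y z)
  obtain t where t: "t \<in> reflections" "z = y \<otimes> t" and y: "y \<in> carrier W" "len y < len z"
    using step(2) unfolding bruhat_step_def by blast
  have y': "z \<otimes> t = y" using t y by simp
  have "len (word_prod W ss \<otimes> t) < len (word_prod W ss)" unfolding step(5) y' by (rule y(2))
  then obtain us s vs where e: "ss = us @ s # vs" "word_prod W (us @ vs) = word_prod W ss \<otimes> t"
    by (rule strong_exchange[OF step(4) t(1)])
  have "us @ vs \<in> lists S" using step(4) e(1) by simp
  moreover have "word_prod W (us @ vs) = y" unfolding e(2) step(5) by (rule y')
  ultimately obtain ts where ts: "subseq ts (us @ vs)" "word_prod W ts = v" using step(3) by blast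
  have "subseq ts ss" unfolding e(1) using ts(1) subseq_delete by (rule subseq_order.order_trans)
  then show ?case using ts(2) by blast
qed

lemma reflection_odd: assumes "t \<in> reflections" shows "odd (len t)"
proof -
  obtain x s where x: "x \<in> carrier W" "s \<in> S" "t = x \<otimes> s \<otimes> inv x"
    using assms by (rule reflectionE)
  then show ?thesis
    using len_mult_parity[of "x \<otimes> s" "inv x"] len_mult_parity[of x s] len_inv[of x] len_gen[of s]
    by simp
qed

text \<open>Left multiplication keeps the reflection \<open>t\<close>, so only the direction of the
  step can change, parity excluding equal lengths. If it is reversed, exchange in
  \<open>s # ss\<close> removes either the head, so that \<open>s \<otimes> u = w\<close>, or a
  letter of \<open>ss\<close>, which would write \<open>w\<close> with fewer than
  \<open>len u\<close> letters.\<close>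

lemma bruhat_step_left:
  assumes "bruhat_step u w" "s \<in> S"
  shows "s \<otimes> u = w \<or> bruhat_step (s \<otimes> u) (s \<otimes> w)"
proof (rule disjCI)
  assume not: "\<not> bruhat_step (s \<otimes> u) (s \<otimes> w)"
  obtain t where t: "t \<in> reflections" "w = u \<otimes> t" and u: "u \<in> carrier W" "len u < len w"
    using assms unfolding bruhat_step_def by blast
  have tc: "t \<in> carrier W" using t by simp
  have sw: "s \<otimes> w = (s \<otimes> u) \<otimes> t" using u t assms by (simp add: m_assoc)
  have "\<not> len (s \<otimes> u) < len (s \<otimes> w)"
  proof -
    have "\<exists>t\<in>reflections. s \<otimes> w = s \<otimes> u \<otimes> t" using sw t(1) by (rule bexI)
    then show ?thesis using not u(1) assms(2) unfolding bruhat_step_def by simp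
  qed
  moreover have "len (s \<otimes> w) \<noteq> len (s \<otimes> u)"
    using len_mult_parity[of "s \<otimes> u" t] reflection_odd[OF t(1)] u tc assms(2) unfolding sw by auto
  ultimately have less: "len (s \<otimes> u \<otimes> t) < len (s \<otimes> u)" using sw by simp
  obtain ss where ss: "ss \<in> lists S" "word_prod W ss = u" "length ss = len u"
    using reduced_exists[OF u(1)] unfolding reduced_expression_def by blast
  have sss: "s # ss \<in> lists S" "word_prod W (s # ss) = s \<otimes> u" using ss assms by auto
  have "len (word_prod W (s # ss) \<otimes> t) < len (word_prod W (s # ss))"
    unfolding sss(2) by (rule less)
  then obtain us x vs where e: "s # ss = us @ x # vs"
    "word_prod W (us @ vs) = word_prod W (s # ss) \<otimes> t"
    by (rule strong_exchange[OF sss(1) t(1)])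
  note e2 = e(2)[unfolded sss(2)]
  show "s \<otimes> u = w"
  proof (cases us)
    case Nil
    then have "word_prod W ss = s \<otimes> u \<otimes> t" using e(1) e2 by simp
    then have "u = s \<otimes> w" by (simp only: ss(2) sw)
    then have "s \<otimes> u = s \<otimes> (s \<otimes> w)" by (rule arg_cong)
    also have "\<dots> = w" using t(2) u(1) tc assms(2) by simp
    finally show ?thesis .
  next
    case (Cons y us')
    then have ss': "y = s" "ss = us' @ x # vs" using e(1) by auto
    then have l: "us' @ vs \<in> lists S" using ss by simp
    have "s \<otimes> word_prod W (us' @ vs) = s \<otimes> w" using e2 sw Cons ss' l assms(2) by simp
    moreover have "w \<in> carrier W" using t(2) u(1) tc by simp
    ultimately have "word_prod W (us' @ vs) = w"
      using l_cancel[of s] word_prod_closed[OF l] gen_closed[OF assms(2)] by blast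
    then have "len w \<le> length (us' @ vs)" using len_le[OF l] by simp
    then show ?thesis using u ss ss' by simp
  qed
qed

text \<open>The multiplied chain runs parallel to the given one until a step \<open>y\<close>,
  \<open>z\<close> with \<open>s \<otimes> y = z\<close> joins the two; from there the given chain
  takes over.\<close>

lemma bruhat_chain_left:
  assumes "bruhat_chain x y" "s \<in> S"
  shows "bruhat_chain (s \<otimes> x) y \<or> bruhat_chain (s \<otimes> x) (s \<otimes> y)"
  using assms(1)
proof (induction rule: rtranclp_induct)
  case (step y z)
  from step(3) show ?case
  proof
    assume "bruhat_chain (s \<otimes> x) y"
    then show ?thesis using step(2) by (meson rtranclp.rtrancl_into_rtrancl)
  next
    assume "bruhat_chain (s \<otimes> x) (s \<otimes> y)"
    then show ?thesis
      using bruhat_step_left[OF step(2) assms(2)] by (metis rtranclp.rtrancl_into_rtrancl)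
  qed
qed auto

lemma bruhat_step_gen:
  assumes "y \<in> carrier W" "s \<in> S" "len y < len (s \<otimes> y)" shows "bruhat_step y (s \<otimes> y)"
proof -
  have "inv y \<otimes> s \<otimes> inv (inv y) \<in> reflections" using assms by (intro reflection_conj) auto
  moreover have "s \<otimes> y = y \<otimes> (inv y \<otimes> s \<otimes> inv (inv y))"
    using assms by (simp add: m_assoc[symmetric])
  ultimately show ?thesis using assms unfolding bruhat_step_def by blast
qed

text \<open>Either the first letter of \<open>ss\<close> is skipped, and one more upward step
  suffices, or both words start with it and \<open>bruhat_chain_left\<close> restores it on the
  chain between the tails.\<close>

lemma subword_imp_chain:
  assumes "reduced ss" "subseq ts ss" "reduced ts"
  shows "bruhat_chain (word_prod W ts) (word_prod W ss)"
  using assms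
proof (induction ss arbitrary: ts)
  case (Cons s ss)
  have r: "s \<in> S" "reduced ss" "len (word_prod W ss) < len (s \<otimes> word_prod W ss)"
    using Cons.prems(1) unfolding reduced_Cons_iff by auto
  have c: "word_prod W ss \<in> carrier W" using r(2) by (simp add: reduced_def)
  note up = bruhat_step_gen[OF c r(1,3)]
  show ?case
  proof (cases "subseq ts ss")
    case True
    then have "bruhat_chain (word_prod W ts) (word_prod W ss)" using Cons r by blast
    then show ?thesis using up by simp
  next
    case False
    then obtain us where us: "ts = s # us" "subseq us ss"
      using Cons.prems(2) by (cases ts) (auto split: if_splits)
    then have "bruhat_chain (word_prod W us) (word_prod W ss)"
      using Cons.IH[OF r(2)] Cons.prems(3) reduced_ConsD by blast
    from bruhat_chain_left[OF this r(1)] show ?thesis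
      unfolding us(1) word_prod_Cons
      using up rtranclp.rtrancl_into_rtrancl[of bruhat_step _ "word_prod W ss"] by blast
  qed
qed (auto dest: list_emb_length)

lemma bruhat_le_iff_chain:
  "bruhat_le W S v w \<longleftrightarrow> w \<in> carrier W \<and> bruhat_chain v w"
proof
  assume "bruhat_le W S v w"
  then obtain ss ts where "reduced ss" "word_prod W ss = w" "subseq ts ss" "reduced ts" "word_prod W ts = v"
    unfolding bruhat_le_def reduced_expression_iff[of v] reduced_expression_iff[of w] by blast
  then show "w \<in> carrier W \<and> bruhat_chain v w"
    using subword_imp_chain[of ss ts] by (auto simp: reduced_def)
next
  assume a: "w \<in> carrier W \<and> bruhat_chain v w"
  then obtain ss where ss: "reduced ss" "word_prod W ss = w"
    using reduced_exists[of w] reduced_expression_iff by blast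
  then have l: "ss \<in> lists S" by (simp add: reduced_def)
  obtain us where us: "subseq us ss" "word_prod W us = v"
    using chain_imp_subword[of v w ss] a l ss by blast
  obtain ts where "subseq ts us" "reduced ts" "word_prod W ts = word_prod W us"
    using reduced_subword[OF subseq_in_lists[OF us(1) l]] by blast
  then show "bruhat_le W S v w"
    unfolding bruhat_le_def reduced_expression_iff[of v] reduced_expression_iff[of w]
    using us ss subseq_order.order_trans by blast
qed

section \<open>Order axioms and the lifting property\<close>

lemma bruhat_closed: "bruhat_le W S v w \<Longrightarrow> v \<in> carrier W \<and> w \<in> carrier W"
  unfolding bruhat_le_iff_chain using bruhat_chain_closed by blast

lemma bruhat_refl: "w \<in> carrier W \<Longrightarrow> bruhat_le W S w w"
  by (simp add: bruhat_le_iff_chain)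

lemma bruhat_trans: "bruhat_le W S u v \<Longrightarrow> bruhat_le W S v w \<Longrightarrow> bruhat_le W S u w"
  unfolding bruhat_le_iff_chain by (blast intro: rtranclp_trans)

lemma bruhat_less_len: "bruhat_le W S v w \<Longrightarrow> v \<noteq> w \<Longrightarrow> len v < len w"
  using bruhat_chain_len unfolding bruhat_le_iff_chain by blast

lemma bruhat_antisym: "bruhat_le W S v w \<Longrightarrow> bruhat_le W S w v \<Longrightarrow> v = w"
  using bruhat_less_len[of v w] bruhat_less_len[of w v] by (cases "v = w") auto

lemma bruhat_one: assumes "w \<in> carrier W" shows "bruhat_le W S \<one> w"
proof -
  obtain ss where "reduced_expression W S w ss" using reduced_exists assms by blast
  moreover have "reduced_expression W S \<one> []" by (simp add: reduced_expression_def)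
  ultimately show ?thesis unfolding bruhat_le_def using list_emb_Nil by blast
qed

lemma bruhat_inv: assumes "bruhat_le W S v w" shows "bruhat_le W S (inv v) (inv w)"
proof -
  obtain ss ts where r: "reduced_expression W S w ss" "subseq ts ss" "reduced_expression W S v ts"
    using assms unfolding bruhat_le_def by blast
  have rev: "reduced_expression W S (inv x) (rev xs)" if "reduced_expression W S x xs" for x xs
    using that word_prod_rev[of xs] len_inv[of x] word_prod_closed[of xs]
    by (simp add: reduced_expression_def)
  have "subseq (rev ts) (rev ss)" using r(2) by (simp add: subseq_rev)
  then show ?thesis using rev r unfolding bruhat_le_def by blast
qed

lemma bruhat_gen_left:
  assumes "y \<in> carrier W" "s \<in> S" "len y < len (s \<otimes> y)" shows "bruhat_le W S y (s \<otimes> y)"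
  using bruhat_step_gen[OF assms] assms by (simp add: bruhat_le_iff_chain)

lemma bruhat_lift_le:
  assumes "bruhat_le W S x y" "s \<in> S" "len (s \<otimes> y) < len y"
  shows "bruhat_le W S (s \<otimes> x) y"
proof -
  have xy: "x \<in> carrier W" "y \<in> carrier W" using bruhat_closed assms by blast+
  have sy: "bruhat_le W S (s \<otimes> y) y"
    using bruhat_gen_left[of "s \<otimes> y" s] assms xy by simp
  have "bruhat_le W S (s \<otimes> x) y \<or> bruhat_le W S (s \<otimes> x) (s \<otimes> y)"
    using bruhat_chain_left[of x y s] assms xy by (auto simp: bruhat_le_iff_chain)
  then show ?thesis using sy bruhat_trans by blast
qed

text \<open>A reduced word of \<open>y\<close> can be chosen to start with \<open>s\<close>. A
  reduced subword for \<open>x\<close> that does not fit into the tail starts with \<open>s\<close>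
  as well and would make \<open>s\<close> a descent of \<open>x\<close>.\<close>

lemma bruhat_lift:
  assumes "bruhat_le W S x y" "s \<in> S" "len (s \<otimes> y) < len y" "len x < len (s \<otimes> x)"
  shows "bruhat_le W S x (s \<otimes> y)"
proof -
  have xy: "x \<in> carrier W" "y \<in> carrier W" using bruhat_closed assms by blast+
  obtain ss where ss: "reduced ss" "word_prod W ss = s \<otimes> y"
    using reduced_exists[of "s \<otimes> y"] reduced_expression_iff xy assms by blast
  have l: "s # ss \<in> lists S" using ss assms by (simp add: reduced_def)
  have "word_prod W (s # ss) = y" using ss xy assms by simp
  then obtain us where us: "subseq us (s # ss)" "word_prod W us = x"
    using chain_imp_subword[of x y "s # ss"] assms(1) l by (auto simp: bruhat_le_iff_chain)
  obtain ts where ts: "subseq ts us" "reduced ts" "word_prod W ts = x"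
    using reduced_subword[OF subseq_in_lists[OF us(1) l]] us(2) by metis
  have sub: "subseq ts (s # ss)" using ts(1) us(1) by (rule subseq_order.order_trans)
  have "subseq ts ss"
  proof (rule ccontr)
    assume "\<not> subseq ts ss"
    then obtain vs where vs: "ts = s # vs" using sub by (cases ts) (auto split: if_splits)
    then have "vs \<in> lists S" using ts(2) by (simp add: reduced_def)
    then have "len (s \<otimes> x) < len x"
      using ts vs assms(2) len_le[of vs] by (auto simp: reduced_def)
    then show False using assms(4) by simp
  qed
  from subword_imp_chain[OF ss(1) this ts(2)] show ?thesis
    using xy assms ss ts by (simp add: bruhat_le_iff_chain)
qed

text \<open>The right-hand versions follow from the left-hand ones by inversion, which preserves
  lengths and the order.\<close>

lemma bruhat_gen_right:
  assumes "y \<in> carrier W" "s \<in> S" "len y < len (y \<otimes> s)" shows "bruhat_le W S y (y \<otimes> s)"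
  using bruhat_inv[OF bruhat_gen_left[of "inv y" s]] assms len_inv[of "y \<otimes> s"] len_inv[of y]
  by (simp add: inv_mult_group)

lemma bruhat_lift_le_right:
  assumes "bruhat_le W S x y" "s \<in> S" "len (y \<otimes> s) < len y"
  shows "bruhat_le W S (x \<otimes> s) y"
proof -
  have "x \<in> carrier W" "y \<in> carrier W" using bruhat_closed assms by blast+
  then show ?thesis
    using bruhat_inv[OF bruhat_lift_le[OF bruhat_inv[OF assms(1)] assms(2)]] assms
      len_inv[of "y \<otimes> s"] len_inv[of y]
    by (simp add: inv_mult_group)
qed

lemma bruhat_lift_right:
  assumes "bruhat_le W S x y" "s \<in> S" "len (y \<otimes> s) < len y" "len x < len (x \<otimes> s)"
  shows "bruhat_le W S x (y \<otimes> s)"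
proof -
  have "x \<in> carrier W" "y \<in> carrier W" using bruhat_closed assms by blast+
  then show ?thesis
    using bruhat_inv[OF bruhat_lift[OF bruhat_inv[OF assms(1)] assms(2)]] assms
      len_inv[of "y \<otimes> s"] len_inv[of y] len_inv[of "x \<otimes> s"] len_inv[of x]
    by (simp add: inv_mult_group)
qed

end

section \<open>The rank of \<open>1 - w \<theta>\<close>\<close>

context vector_space
begin

text \<open>\<open>dim\<close> is the cardinality of a basis and carries no information when the
  basis is infinite. The ambient function space may be of this kind, so the comparisons below come
  with a finite set \<open>F\<close> whose span contains \<open>V\<close>.\<close>

lemma finite_basis_exists:
  assumes "finite F" "V \<subseteq> span F"
  obtains B where "B \<subseteq> V" "independent B" "V \<subseteq> span B" "card B = dim V" "finite B"
proof -
  obtain B where B: "B \<subseteq> V" "independent B" "V \<subseteq> span B" "card B = dim V"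
    by (rule basis_exists)
  have "finite B" using independent_span_bound[OF assms(1) B(2)] B(1) assms(2) by blast
  then show thesis using that B by blast
qed

lemma dim_le_in_finite_span:
  assumes "finite F" "V \<subseteq> span F" "U \<subseteq> V" shows "dim U \<le> dim V"
proof -
  obtain B where B: "V \<subseteq> span B" "card B = dim V" "finite B"
    by (rule finite_basis_exists[OF assms(1,2)])
  then have "dim U \<le> card B" using assms(3) by (intro dim_le_card) auto
  then show ?thesis using B(2) by simp
qed

lemma dim_le_Suc_dim:
  assumes "finite F" "V \<subseteq> span F" "U \<subseteq> span (insert a V)" shows "dim U \<le> Suc (dim V)"
proof -
  obtain B where B: "V \<subseteq> span B" "card B = dim V" "finite B"
    by (rule finite_basis_exists[OF assms(1,2)])
  have "insert a V \<subseteq> span (insert a B)"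
    using B(1) span_mono[of B "insert a B"] span_base[of a "insert a B"] by blast
  then have "span (insert a V) \<subseteq> span (insert a B)" by (rule span_minimal) (rule subspace_span)
  then have "dim U \<le> card (insert a B)" using assms(3) B(3) by (intro dim_le_card) auto
  also have "\<dots> \<le> Suc (dim V)" using B(2,3) by (simp add: card_insert_if)
  finally show ?thesis .
qed

lemma Suc_dim_le_dim:
  assumes "finite F" "V \<subseteq> span F" "subspace U" "U \<subseteq> V" "a \<in> V" "a \<notin> U"
  shows "Suc (dim U) \<le> dim V"
proof -
  obtain C where C: "V \<subseteq> span C" "card C = dim V" "finite C"
    by (rule finite_basis_exists[OF assms(1,2)])
  have "U \<subseteq> span F" using assms by blast
  from finite_basis_exists[OF assms(1) this] obtain B where
    B: "B \<subseteq> U" "independent B" "card B = dim U" "finite B" by metis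
  have "a \<notin> span B" using span_minimal[OF B(1) assms(3)] assms(6) by blast
  then have "independent (insert a B)" using B(2) by (rule independent_insertI)
  moreover have "insert a B \<subseteq> span C" using B(1) C(1) assms by blast
  ultimately have "card (insert a B) \<le> card C" using independent_span_bound[OF C(3)] by blast
  moreover have "a \<notin> B" using B(1) assms(6) by blast
  ultimately show ?thesis using B C by simp
qed

end

lemma dim_linear_image_le:
  assumes "linear_fun f" "finite F" "V \<subseteq> fun_vs.span F"
  shows "fun_vs.dim (f ` V) \<le> fun_vs.dim V"
proof -
  obtain B where B: "V \<subseteq> fun_vs.span B" "card B = fun_vs.dim V" "finite B"
    by (rule fun_vs.finite_basis_exists[OF assms(2,3)])
  have "module_hom scale_fun scale_fun f" using assms(1) by (simp only: module_hom_iff_linear)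
  then have "f ` V \<subseteq> fun_vs.span (f ` B)" using B(1) by (rule module_hom.spans_image)
  then have "fun_vs.dim (f ` V) \<le> card (f ` B)" using B(3) by (intro fun_vs.dim_le_card) simp_all
  also have "\<dots> \<le> card B" using B(3) by (rule card_image_le)
  finally show ?thesis using B(2) by simp
qed

locale twisted_coxeter_group = coxeter_group +
  fixes \<theta> :: "'a \<Rightarrow> 'a"
  assumes theta_iso: "\<theta> \<in> iso W W"
    and theta_theta [simp]: "x \<in> carrier W \<Longrightarrow> \<theta> (\<theta> x) = x"
    and theta_gens: "\<theta> ` S = S"
begin

lemma theta_closed [simp, intro]: "x \<in> carrier W \<Longrightarrow> \<theta> x \<in> carrier W"
  using theta_iso by (auto simp: iso_def hom_def)

lemma theta_mult: "x \<in> carrier W \<Longrightarrow> y \<in> carrier W \<Longrightarrow> \<theta> (x \<otimes> y) = \<theta> x \<otimes> \<theta> y"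
  using theta_iso by (auto simp: iso_def hom_def)

lemma theta_gen [simp, intro]: "s \<in> S \<Longrightarrow> \<theta> s \<in> S"
  using theta_gens by blast

lemma theta_one [simp]: "\<theta> \<one> = \<one>"
  using theta_mult[of \<one> \<one>] r_cancel_one[of "\<theta> \<one>" "\<theta> \<one>"] by simp

lemma theta_inv: "x \<in> carrier W \<Longrightarrow> \<theta> (inv x) = inv (\<theta> x)"
  using theta_mult[of "inv x" x] inv_equality[of "\<theta> (inv x)" "\<theta> x"] by simp

lemma theta_eq_one_iff: "x \<in> carrier W \<Longrightarrow> \<theta> x = \<one> \<longleftrightarrow> x = \<one>"
  by (metis theta_one theta_theta)

lemma theta_word_prod: "ss \<in> lists S \<Longrightarrow> \<theta> (word_prod W ss) = word_prod W (map \<theta> ss)"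
  by (induction rule: lists.induct) (simp_all add: theta_mult)

lemma theta_words: "ss \<in> lists S \<Longrightarrow> map \<theta> ss \<in> lists S"
  by (induction rule: lists.induct) simp_all

lemma len_theta: assumes "w \<in> carrier W" shows "len (\<theta> w) = len w"
proof -
  have le: "len (\<theta> x) \<le> len x" if x: "x \<in> carrier W" for x
  proof -
    obtain ss where "reduced_expression W S x ss" using reduced_exists x by blast
    then show ?thesis
      using len_le[of "map \<theta> ss"] theta_words[of ss] theta_word_prod[of ss]
      by (auto simp: reduced_expression_def)
  qed
  show ?thesis using le[of w] le[of "\<theta> w"] assms by simp
qed

lemma theta_pow: "x \<in> carrier W \<Longrightarrow> \<theta> (x [^] (n::nat)) = \<theta> x [^] n"
  by (induction n) (simp_all add: theta_mult)

lemma ord_theta: assumes "x \<in> carrier W" shows "ord (\<theta> x) = ord x"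
proof -
  have "\<theta> x [^] n = \<one> \<longleftrightarrow> ord x dvd n" for n :: nat
    using assms theta_eq_one_iff[of "x [^] n"] by (simp add: theta_pow pow_eq_id)
  then show ?thesis using ord_unique[of "\<theta> x" "ord x"] assms by simp
qed

lemma cosine_theta: "s \<in> S \<Longrightarrow> t \<in> S \<Longrightarrow> cosine (\<theta> s) (\<theta> t) = cosine s t"
  using ord_theta[of "s \<otimes> t"] by (simp add: cosine_def theta_mult)

text \<open>The linear map that permutes the simple roots by \<theta>; precomposition does this
  because \<theta> is its own inverse on \<open>S\<close>. Coordinates outside \<open>S\<close> are
  left alone, so that they do not contribute to the displacement.\<close>

definition diagram_map :: "('a \<Rightarrow> real) \<Rightarrow> 'a \<Rightarrow> real" where
  "diagram_map v = (\<lambda>x. if x \<in> S then v (\<theta> x) else v x)"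

lemma diagram_map_linear: "linear_fun diagram_map"
  by (rule linear_funI) (simp_all add: diagram_map_def fun_eq_iff)

lemma diagram_map_unit: assumes "s \<in> S" shows "diagram_map (unit_fun s) = unit_fun (\<theta> s)"
proof
  fix x
  have "x \<in> S \<Longrightarrow> \<theta> x = s \<longleftrightarrow> x = \<theta> s" using assms by (metis gen_closed theta_theta)
  then show "diagram_map (unit_fun s) x = unit_fun (\<theta> s) x"
    using assms by (auto simp: diagram_map_def unit_fun_apply)
qed

lemma diagram_map_involutive [simp]: "diagram_map (diagram_map v) = v"
  by (simp add: diagram_map_def fun_eq_iff)

lemma theta_bij: "bij_betw \<theta> S S"
  by (rule bij_betw_byWitness[of _ \<theta>]) (use theta_gens in auto)

lemma diagram_map_reflect:
  assumes "s \<in> S" shows "diagram_map (reflect s v) = reflect (\<theta> s) (diagram_map v)"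
proof -
  have "coroot (\<theta> s) (diagram_map v) = (\<Sum>t\<in>S. cosine (\<theta> s) (\<theta> t) * diagram_map v (\<theta> t))"
    unfolding coroot_def by (rule sum.reindex_bij_betw[OF theta_bij, symmetric])
  also have "\<dots> = coroot s v"
    unfolding coroot_def by (rule sum.cong[OF HOL.refl]) (simp add: assms cosine_theta diagram_map_def)
  finally have c: "coroot (\<theta> s) (diagram_map v) = coroot s v" .
  show ?thesis
    unfolding reflect_def c linear_fun_diff[OF diagram_map_linear] linear_fun_scale[OF diagram_map_linear]
      diagram_map_unit[OF assms] ..
qed

lemma diagram_map_rep:
  assumes "w \<in> carrier W" shows "diagram_map (rep w v) = rep (\<theta> w) (diagram_map v)"
proof -
  obtain ss where ss: "ss \<in> lists S" "word_prod W ss = w" using word_exists assms by blast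
  have "diagram_map (act ss v) = act (map \<theta> ss) (diagram_map v)"
    using ss(1) by (induction rule: lists.induct) (simp_all add: diagram_map_reflect)
  then show ?thesis
    using rep_word_prod[OF ss(1)] rep_word_prod[OF theta_words[OF ss(1)]] theta_word_prod[OF ss(1)] ss(2)
    by simp
qed

text \<open>The action of the element \<open>w \<theta>\<close> of the semidirect product of \<open>W\<close> with \<open>{1, \<theta>}\<close>.\<close>
definition twisted_rep :: "'a \<Rightarrow> ('a \<Rightarrow> real) \<Rightarrow> 'a \<Rightarrow> real" where
  "twisted_rep w v = rep w (diagram_map v)"

section \<open>Displacement spaces\<close>

definition displacement :: "'a \<Rightarrow> ('a \<Rightarrow> real) set" where
  "displacement w = range (\<lambda>v. v - twisted_rep w v)"

text \<open>The image of 1 - w \<theta> is measured and not its kernel: the kernel contains every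
  function vanishing on \<open>S\<close>, while the image lies in the span of the simple
  roots.\<close>

definition moved_dim :: "'a \<Rightarrow> nat" where
  "moved_dim w = fun_vs.dim (displacement w)"

lemma twisted_rep_linear: "linear_fun (twisted_rep w)"
  using linear_fun_compose[OF rep_linear diagram_map_linear] by (simp only: twisted_rep_def[abs_def])

lemma twisted_rep_mult:
  "x \<in> carrier W \<Longrightarrow> w \<in> carrier W \<Longrightarrow> twisted_rep (x \<otimes> w) v = rep x (twisted_rep w v)"
  unfolding twisted_rep_def by (rule rep_mult)

lemma subspace_displacement: "fun_vs.subspace (displacement w)"
proof -
  note lin = twisted_rep_linear[of w]
  have "linear_fun (\<lambda>v. v - twisted_rep w v)"
  proof (rule linear_funI)
    fix u v c
    show "u + v - twisted_rep w (u + v) = u - twisted_rep w u + (v - twisted_rep w v)"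
      unfolding linear_fun_add[OF lin] by simp
    show "c *\<^sub>F v - twisted_rep w (c *\<^sub>F v) = c *\<^sub>F (v - twisted_rep w v)"
      unfolding linear_fun_scale[OF lin] by (simp only: fun_vs.scale_right_diff_distrib)
  qed
  then have "module_hom scale_fun scale_fun (\<lambda>v. v - twisted_rep w v)"
    by (simp only: module_hom_iff_linear)
  then show ?thesis
    unfolding displacement_def by (rule module_hom.subspace_image) (rule fun_vs.subspace_UNIV)
qed

lemma displacement_in_span:
  assumes "w \<in> carrier W" shows "displacement w \<subseteq> fun_vs.span (unit_fun ` S)"
proof
  fix u assume "u \<in> displacement w"
  then obtain v where u: "u = v - twisted_rep w v" unfolding displacement_def by blast
  obtain ss where ss: "ss \<in> lists S" "word_prod W ss = w" using word_exists assms by blast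
  have "u x = 0" if x: "x \<notin> S" for x
  proof -
    have "act ss v' x = v' x" for v'
      using ss(1) x by (induction rule: lists.induct) (auto simp: reflect_def unit_fun_apply)
    then have "twisted_rep w v x = v x"
      unfolding twisted_rep_def ss(2)[symmetric] rep_word_prod[OF ss(1)] using x by (simp add: diagram_map_def)
    then show ?thesis by (simp add: u)
  qed
  then have "u = (\<lambda>x. \<Sum>s\<in>S. (u s *\<^sub>F unit_fun s) x)"
    using finite_gens by (auto simp: fun_eq_iff unit_fun_apply if_distrib cong: if_cong)
  also have "\<dots> = (\<Sum>s\<in>S. u s *\<^sub>F unit_fun s)"
  proof
    fix x show "(\<Sum>s\<in>S. (u s *\<^sub>F unit_fun s) x) = (\<Sum>s\<in>S. u s *\<^sub>F unit_fun s) x"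
      using finite_gens by (induction rule: finite_induct) simp_all
  qed
  also have "\<dots> \<in> fun_vs.span (unit_fun ` S)"
    by (intro fun_vs.span_sum fun_vs.span_scale fun_vs.span_base) simp
  finally show "u \<in> fun_vs.span (unit_fun ` S)" .
qed

text \<open>Inserting \<open>s\<close> alters the operator by a map with image in the line of the
  root \<open>rep x (unit_fun s)\<close>. The free left factor \<open>x\<close> covers an insertion
  at any position of a word.\<close>

lemma moved_dim_insert_le:
  assumes "x \<in> carrier W" "y \<in> carrier W" "s \<in> S"
  shows "moved_dim (x \<otimes> (s \<otimes> y)) \<le> Suc (moved_dim (x \<otimes> y))"
proof -
  have xy: "x \<otimes> y \<in> carrier W" using assms by simp
  let ?a = "rep x (unit_fun s)"
  have "displacement (x \<otimes> (s \<otimes> y)) \<subseteq> fun_vs.span (insert ?a (displacement (x \<otimes> y)))"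
  proof
    fix u assume "u \<in> displacement (x \<otimes> (s \<otimes> y))"
    then obtain v where u: "u = v - twisted_rep (x \<otimes> (s \<otimes> y)) v" unfolding displacement_def by blast
    have sy: "s \<otimes> y \<in> carrier W" and s: "s \<in> carrier W" using assms by simp_all
    let ?c = "2 * coroot s (twisted_rep y v)"
    have "twisted_rep (x \<otimes> (s \<otimes> y)) v = twisted_rep (x \<otimes> y) v - ?c *\<^sub>F ?a"
      unfolding twisted_rep_mult[OF assms(1) sy] twisted_rep_mult[OF s assms(2)]
        twisted_rep_mult[OF assms(1,2)] rep_gen[OF assms(3)] reflect_def
        linear_fun_diff[OF rep_linear] linear_fun_scale[OF rep_linear] ..
    then have "u = (v - twisted_rep (x \<otimes> y) v) + ?c *\<^sub>F ?a" unfolding u by simp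
    moreover have "v - twisted_rep (x \<otimes> y) v \<in> displacement (x \<otimes> y)" unfolding displacement_def by blast
    ultimately show "u \<in> fun_vs.span (insert ?a (displacement (x \<otimes> y)))"
      by (simp only:) (intro fun_vs.span_add fun_vs.span_scale fun_vs.span_base insertI1 insertI2)
  qed
  then show ?thesis
    unfolding moved_dim_def
    by (rule fun_vs.dim_le_Suc_dim[OF finite_imageI[OF finite_gens] displacement_in_span[OF xy]])
qed

text \<open>As operators, \<theta>(x^-1) \<theta> = \<theta> x^-1, so 1 - x w \<theta>(x^-1)
  \<theta> is the conjugate of 1 - w \<theta> by \<open>x\<close>.\<close>

lemma moved_dim_conj_le:
  assumes "x \<in> carrier W" "w \<in> carrier W"
  shows "moved_dim (x \<otimes> w \<otimes> \<theta> (inv x)) \<le> moved_dim w"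
proof -
  have "displacement (x \<otimes> w \<otimes> \<theta> (inv x)) \<subseteq> rep x ` displacement w"
  proof
    fix u assume "u \<in> displacement (x \<otimes> w \<otimes> \<theta> (inv x))"
    then obtain v where u: "u = v - twisted_rep (x \<otimes> w \<otimes> \<theta> (inv x)) v" unfolding displacement_def by blast
    have c: "inv x \<in> carrier W" "\<theta> (inv x) \<in> carrier W" "w \<otimes> \<theta> (inv x) \<in> carrier W"
      using assms by simp_all
    have "twisted_rep (x \<otimes> w \<otimes> \<theta> (inv x)) v = rep x (rep w (rep (\<theta> (inv x)) (diagram_map v)))"
      using assms c by (simp add: twisted_rep_def rep_mult m_assoc)
    also have "\<dots> = rep x (twisted_rep w (rep (inv x) v))"
      unfolding diagram_map_rep[OF c(1), symmetric] twisted_rep_def ..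
    finally have e: "twisted_rep (x \<otimes> w \<otimes> \<theta> (inv x)) v = rep x (twisted_rep w (rep (inv x) v))" .
    have "v = rep x (rep (inv x) v)" using rep_mult[of x "inv x" v] assms by simp
    then have "u = rep x (rep (inv x) v) - rep x (twisted_rep w (rep (inv x) v))" unfolding u e by simp
    also have "\<dots> = rep x (rep (inv x) v - twisted_rep w (rep (inv x) v))"
      by (simp only: linear_fun_diff[OF rep_linear])
    finally show "u \<in> rep x ` displacement w" unfolding displacement_def by blast
  qed
  moreover have fin: "finite (rep x ` unit_fun ` S)" using finite_gens by simp
  moreover have "rep x ` displacement w \<subseteq> fun_vs.span (rep x ` unit_fun ` S)"
    by (rule module_hom.spans_image[OF _ displacement_in_span[OF assms(2)]])
      (simp only: module_hom_iff_linear rep_linear)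
  ultimately have "moved_dim (x \<otimes> w \<otimes> \<theta> (inv x)) \<le> fun_vs.dim (rep x ` displacement w)"
    unfolding moved_dim_def by (intro fun_vs.dim_le_in_finite_span)
  also have "\<dots> \<le> moved_dim w"
    unfolding moved_dim_def
    by (rule dim_linear_image_le[OF rep_linear finite_imageI[OF finite_gens] displacement_in_span[OF assms(2)]])
  finally show ?thesis .
qed

lemma moved_dim_conj:
  assumes "x \<in> carrier W" "w \<in> carrier W"
  shows "moved_dim (x \<otimes> w \<otimes> \<theta> (inv x)) = moved_dim w"
proof (rule antisym[OF moved_dim_conj_le[OF assms]])
  have "inv x \<otimes> (x \<otimes> w \<otimes> \<theta> (inv x)) \<otimes> \<theta> (inv (inv x)) = w"
    using assms by (simp add: theta_inv m_assoc) (simp add: m_assoc[symmetric])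
  then show "moved_dim w \<le> moved_dim (x \<otimes> w \<otimes> \<theta> (inv x))"
    using moved_dim_conj_le[of "inv x" "x \<otimes> w \<otimes> \<theta> (inv x)"] assms by simp
qed

abbreviation tw_invs :: "'a set" where "tw_invs \<equiv> twisted_involutions W \<theta>"

lemma tw_invsD: "w \<in> tw_invs \<Longrightarrow> w \<in> carrier W" "w \<in> tw_invs \<Longrightarrow> \<theta> w = inv w"
  by (auto simp: twisted_involutions_def)

lemma twisted_rep_involutive: assumes "w \<in> tw_invs" shows "twisted_rep w (twisted_rep w v) = v"
proof -
  have w: "w \<in> carrier W" using assms by (rule tw_invsD)
  have "twisted_rep w (twisted_rep w v) = rep w (rep (\<theta> w) v)"
    unfolding twisted_rep_def diagram_map_rep[OF w] by simp
  also have "\<dots> = rep (w \<otimes> \<theta> w) v" by (rule rep_mult[symmetric]) (use w in simp_all)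
  also have "\<dots> = v" using tw_invsD(2)[OF assms] w by simp
  finally show ?thesis .
qed

text \<open>
  The simple root of \<open>s\<close> is fixed by \<open>w \<theta>\<close> and negated by \<open>s w \<theta>\<close>, so the \<open>-1\<close>-eigenspace grows by
  exactly one dimension.
\<close>
lemma moved_dim_Suc:
  assumes w: "w \<in> tw_invs" and s: "s \<in> S" and comm: "s \<otimes> w = w \<otimes> \<theta> s"
    and up: "len w < len (s \<otimes> w)"
  shows "moved_dim (s \<otimes> w) = Suc (moved_dim w)"
proof (rule antisym)
  have wc: "w \<in> carrier W" using w by (rule tw_invsD)
  have swc: "s \<otimes> w \<in> carrier W" using wc s by simp
  show "moved_dim (s \<otimes> w) \<le> Suc (moved_dim w)"
    using moved_dim_insert_le[OF one_closed wc s] wc s by simp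
  let ?a = "unit_fun s"
  \<comment> \<open>The image under \<open>w\<close> of the simple root of \<open>\<theta> s\<close>
    is positive since the length grows, and \<open>s\<close> negates it because
    \<open>s \<otimes> w = w \<otimes> \<theta> s\<close>; a root with this sign change is the
    simple root of \<open>s\<close>.\<close>
  have pos: "0 \<le> rep w (unit_fun (\<theta> s))"
    using up unfolding comm by (rule rep_unit_nonneg[OF wc theta_gen[OF s]])
  have "reflect s (rep w (unit_fun (\<theta> s))) = rep (s \<otimes> w) (unit_fun (\<theta> s))"
    unfolding rep_mult[OF gen_closed[OF s] wc] rep_gen[OF s] ..
  also have "\<dots> = - rep w (unit_fun (\<theta> s))"
    unfolding comm by (rule rep_mult_gen_unit[OF wc theta_gen[OF s]])
  finally have neg: "reflect s (rep w (unit_fun (\<theta> s))) \<le> 0" using pos by (simp only: neg_le_0_iff_le)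
  have a: "twisted_rep w ?a = ?a"
    unfolding twisted_rep_def diagram_map_unit[OF s]
    by (rule root_sign_change[OF wc s theta_gen[OF s] pos neg])
  have sw: "twisted_rep (s \<otimes> w) v = reflect s (twisted_rep w v)" for v
    unfolding twisted_rep_mult[OF gen_closed[OF s] wc] rep_gen[OF s] ..
  \<comment> \<open>The involution \<open>w \<theta>\<close> acts as - 1 on its displacement space
    but fixes \<open>?a\<close>.\<close>
  have not_in: "?a \<notin> displacement w"
  proof
    assume "?a \<in> displacement w"
    then obtain v where v: "?a = v - twisted_rep w v" unfolding displacement_def by blast
    have "?a = twisted_rep w (v - twisted_rep w v)" unfolding v[symmetric] a ..
    also have "\<dots> = twisted_rep w v - v"
      unfolding linear_fun_diff[OF twisted_rep_linear] twisted_rep_involutive[OF w] ..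
    also have "\<dots> = - ?a" unfolding v by simp
    finally have "?a s = (- ?a) s" by (rule fun_cong)
    then show False by (simp add: unit_fun_apply)
  qed
  \<comment> \<open>\<open>s w \<theta>\<close> negates \<open>?a\<close>, so half of
    \<open>?a\<close> is displaced by exactly \<open>?a\<close>.\<close>
  have "(1/2) *\<^sub>F ?a - twisted_rep (s \<otimes> w) ((1/2) *\<^sub>F ?a) = ?a"
    unfolding linear_fun_scale[OF twisted_rep_linear] sw a reflect_unit_same[OF s]
    by (simp add: fun_eq_iff)
  then have a_in: "?a \<in> displacement (s \<otimes> w)" unfolding displacement_def by (metis rangeI)
  have sub: "displacement w \<subseteq> displacement (s \<otimes> w)"
  proof
    fix u assume "u \<in> displacement w"
    then obtain v where u: "u = v - twisted_rep w v" unfolding displacement_def by blast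
    have "u = (v - twisted_rep (s \<otimes> w) v) - (2 * coroot s (twisted_rep w v)) *\<^sub>F ?a"
      unfolding u sw reflect_def by simp
    moreover have "v - twisted_rep (s \<otimes> w) v \<in> displacement (s \<otimes> w)" unfolding displacement_def by blast
    ultimately show "u \<in> displacement (s \<otimes> w)"
      using fun_vs.subspace_diff[OF subspace_displacement _
          fun_vs.subspace_scale[OF subspace_displacement a_in]] by (simp only:)
  qed
  show "Suc (moved_dim w) \<le> moved_dim (s \<otimes> w)"
    unfolding moved_dim_def
    by (rule fun_vs.Suc_dim_le_dim[OF finite_imageI[OF finite_gens] displacement_in_span[OF swc]
          subspace_displacement sub a_in not_in])
qed

end

section \<open>Twisted involutions\<close>

context twisted_coxeter_group
begin

definition twist :: "'a \<Rightarrow> 'a \<Rightarrow> 'a" where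
  "twist w s = (if s \<otimes> w \<otimes> \<theta> s = w then s \<otimes> w else s \<otimes> w \<otimes> \<theta> s)"

lemma theta_gen_mult_inv:
  assumes "w \<in> tw_invs" "s \<in> S"
  shows "\<theta> (s \<otimes> w) = inv (w \<otimes> \<theta> s)" "\<theta> (s \<otimes> w \<otimes> \<theta> s) = inv (s \<otimes> w \<otimes> \<theta> s)"
  using tw_invsD[OF assms(1)] assms(2)
  by (simp_all add: theta_mult inv_mult_group m_assoc)

text \<open>\<theta> takes \<open>s \<otimes> w\<close> to the inverse of
  \<open>w \<otimes> \<theta> s\<close>, and neither \<theta> nor inversion changes the length. So
  \<open>s\<close> is a left descent exactly if \<open>\<theta> s\<close> is a right
  descent.\<close>

lemma len_mult_theta:
  assumes "w \<in> tw_invs" "s \<in> S" shows "len (w \<otimes> \<theta> s) = len (s \<otimes> w)"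
  using theta_gen_mult_inv(1)[OF assms] len_theta[of "s \<otimes> w"] len_inv[of "w \<otimes> \<theta> s"]
    tw_invsD(1)[OF assms(1)] assms(2) by simp

lemma commute_iff:
  assumes "w \<in> carrier W" "s \<in> S"
  shows "s \<otimes> w \<otimes> \<theta> s = w \<longleftrightarrow> s \<otimes> w = w \<otimes> \<theta> s"
proof
  assume "s \<otimes> w \<otimes> \<theta> s = w"
  then have "s \<otimes> w \<otimes> \<theta> s \<otimes> \<theta> s = w \<otimes> \<theta> s" by (rule arg_cong)
  then show "s \<otimes> w = w \<otimes> \<theta> s" using assms by simp
next
  assume "s \<otimes> w = w \<otimes> \<theta> s"
  then show "s \<otimes> w \<otimes> \<theta> s = w" using assms by simp
qed

lemma twist_in_tw_invs:
  assumes "w \<in> tw_invs" "s \<in> S" shows "twist w s \<in> tw_invs"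
  using theta_gen_mult_inv[OF assms] commute_iff[OF tw_invsD(1)[OF assms(1)] assms(2)]
    tw_invsD(1)[OF assms(1)] assms(2)
  by (auto simp: twist_def twisted_involutions_def)

text \<open>If the second multiplication did not lengthen, exchange in \<open>s # ss\<close> would
  delete either the head, giving \<open>s \<otimes> w \<otimes> \<theta> s = w\<close>, or a letter
  of \<open>ss\<close>, giving \<open>w \<otimes> \<theta> s\<close> with fewer than
  \<open>len w\<close> letters although it is as long as \<open>s \<otimes> w\<close>.\<close>

lemma len_two_sided_up:
  assumes w: "w \<in> tw_invs" and s: "s \<in> S" and up: "len w < len (s \<otimes> w)"
    and ne: "s \<otimes> w \<otimes> \<theta> s \<noteq> w"
  shows "len (s \<otimes> w \<otimes> \<theta> s) = len w + 2"
proof (rule ccontr)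
  assume not: "len (s \<otimes> w \<otimes> \<theta> s) \<noteq> len w + 2"
  have wc: "w \<in> carrier W" using w by (rule tw_invsD)
  have l1: "len (s \<otimes> w) = Suc (len w)" using len_gen_mult[OF s wc] up by linarith
  obtain ss where ss: "ss \<in> lists S" "word_prod W ss = w" "length ss = len w"
    using reduced_exists[OF wc] unfolding reduced_expression_def by blast
  have sss: "s # ss \<in> lists S" "word_prod W (s # ss) = s \<otimes> w" using ss s by auto
  have "len (word_prod W (s # ss) \<otimes> \<theta> s) < len (word_prod W (s # ss))"
    unfolding sss(2) using len_mult_gen[OF theta_gen[OF s], of "s \<otimes> w"] wc s l1 not by auto
  then obtain us x vs where e: "s # ss = us @ x # vs"
    "word_prod W (us @ vs) = word_prod W (s # ss) \<otimes> \<theta> s"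
    by (rule strong_exchange[OF sss(1) gen_in_reflections[OF theta_gen[OF s]]])
  note e2 = e(2)[unfolded sss(2)]
  show False
  proof (cases us)
    case Nil
    then have "word_prod W ss = s \<otimes> w \<otimes> \<theta> s" using e(1) e2 by simp
    then have "w = s \<otimes> w \<otimes> \<theta> s" by (simp only: ss(2))
    with ne show False by metis
  next
    case (Cons y us')
    then have ss': "y = s" "ss = us' @ x # vs" using e(1) by auto
    then have l: "us' @ vs \<in> lists S" using ss(1) by simp
    have "s \<otimes> word_prod W (us' @ vs) = s \<otimes> (w \<otimes> \<theta> s)"
      using e2 Cons ss' l s wc by (simp add: m_assoc)
    moreover have "w \<otimes> \<theta> s \<in> carrier W" using wc s by simp
    ultimately have "word_prod W (us' @ vs) = w \<otimes> \<theta> s"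
      using l_cancel[of s] word_prod_closed[OF l] gen_closed[OF s] by blast
    then have "len (w \<otimes> \<theta> s) \<le> length (us' @ vs)" using len_le[OF l] by simp
    then show False using len_mult_theta[OF w s] l1 ss(3) ss'(2) by simp
  qed
qed

text \<open>The same exchange, now in a reduced word of \<open>w\<close> that starts with
  \<open>s\<close>: deleting the head would mean
  \<open>s \<otimes> w = w \<otimes> \<theta> s\<close>, so the deleted letter is a further one and
  two letters are lost.\<close>

lemma len_two_sided_down:
  assumes w: "w \<in> tw_invs" and s: "s \<in> S" and down: "len (s \<otimes> w) < len w"
    and ne: "s \<otimes> w \<otimes> \<theta> s \<noteq> w"
  shows "len (s \<otimes> w \<otimes> \<theta> s) + 2 = len w"
proof -
  have wc: "w \<in> carrier W" using w by (rule tw_invsD)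
  have l1: "len w = Suc (len (s \<otimes> w))" using len_gen_mult[OF s wc] down by linarith
  obtain ss where ss: "ss \<in> lists S" "word_prod W ss = s \<otimes> w" "length ss = len (s \<otimes> w)"
    using reduced_exists[of "s \<otimes> w"] wc s unfolding reduced_expression_def by blast
  have sss: "s # ss \<in> lists S" "word_prod W (s # ss) = w" using ss s wc by auto
  have "len (word_prod W (s # ss) \<otimes> \<theta> s) < len (word_prod W (s # ss))"
    unfolding sss(2) len_mult_theta[OF w s] by (rule down)
  then obtain us x vs where e: "s # ss = us @ x # vs"
    "word_prod W (us @ vs) = word_prod W (s # ss) \<otimes> \<theta> s"
    by (rule strong_exchange[OF sss(1) gen_in_reflections[OF theta_gen[OF s]]])
  note e2 = e(2)[unfolded sss(2)]
  show ?thesis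
  proof (cases us)
    case Nil
    then have "word_prod W ss = w \<otimes> \<theta> s" using e(1) e2 by simp
    then have "s \<otimes> w = w \<otimes> \<theta> s" by (simp only: ss(2))
    then show ?thesis using ne commute_iff[OF wc s] by blast
  next
    case (Cons y us')
    then have ss': "y = s" "ss = us' @ x # vs" using e(1) by auto
    then have l: "us' @ vs \<in> lists S" using ss(1) by simp
    have "s \<otimes> word_prod W (us' @ vs) = w \<otimes> \<theta> s" using e2 Cons ss' l s by simp
    then have "s \<otimes> (s \<otimes> word_prod W (us' @ vs)) = s \<otimes> (w \<otimes> \<theta> s)" by (rule arg_cong)
    then have "word_prod W (us' @ vs) = s \<otimes> w \<otimes> \<theta> s"
      using word_prod_closed[OF l] s wc by (simp add: m_assoc)
    then have "len (s \<otimes> w \<otimes> \<theta> s) \<le> length (us' @ vs)" using len_le[OF l] by simp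
    moreover have "len (s \<otimes> w) \<le> Suc (len (s \<otimes> w \<otimes> \<theta> s))"
      using len_mult_gen[OF theta_gen[OF s], of "s \<otimes> w"] wc s by auto
    ultimately show ?thesis using l1 ss(3) ss'(2) by simp
  qed
qed

text \<open>Twisting turns an ascent into a descent and undoes itself, so a downward step is an
  upward step read backwards; \<open>twist_down_le\<close> exploits this.\<close>

lemma twist_up:
  assumes w: "w \<in> tw_invs" and s: "s \<in> S" and up: "len w < len (s \<otimes> w)"
  shows "len (s \<otimes> twist w s) < len (twist w s)" and "twist (twist w s) s = w"
    and "len (twist w s) + moved_dim (twist w s) = len w + moved_dim w + 2"
    and "bruhat_le W S w (twist w s)"
proof -
  have wc: "w \<in> carrier W" using w by (rule tw_invsD)
  have l1: "len (s \<otimes> w) = Suc (len w)" using len_gen_mult[OF s wc] up by linarith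
  have le: "bruhat_le W S w (s \<otimes> w)" by (rule bruhat_gen_left[OF wc s up])
  have "len (s \<otimes> twist w s) < len (twist w s) \<and> twist (twist w s) s = w \<and>
    len (twist w s) + moved_dim (twist w s) = len w + moved_dim w + 2 \<and> bruhat_le W S w (twist w s)"
  proof (cases "s \<otimes> w \<otimes> \<theta> s = w")
    case True
    then have comm: "s \<otimes> w = w \<otimes> \<theta> s" using commute_iff[OF wc s] by blast
    have tw: "twist w s = s \<otimes> w" using True by (simp add: twist_def)
    have "s \<otimes> (s \<otimes> w) \<otimes> \<theta> s = s \<otimes> w"
      by (simp only: gen_cancel(1)[OF s wc] comm[symmetric])
    then have "twist (s \<otimes> w) s = w" using wc s by (simp add: twist_def)
    then show ?thesis unfolding tw using moved_dim_Suc[OF w s comm up] l1 le wc s by simp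
  next
    case False
    have tw: "twist w s = s \<otimes> w \<otimes> \<theta> s" using False by (simp add: twist_def)
    note l2 = len_two_sided_up[OF w s up False]
    have st: "s \<otimes> (s \<otimes> w \<otimes> \<theta> s) = w \<otimes> \<theta> s" using wc s by (simp add: m_assoc)
    have "twist (s \<otimes> w \<otimes> \<theta> s) s = w"
    proof -
      have "s \<otimes> (s \<otimes> w \<otimes> \<theta> s) \<otimes> \<theta> s = w" unfolding st using wc s by simp
      then show ?thesis using False by (simp add: twist_def)
    qed
    moreover have "moved_dim (s \<otimes> w \<otimes> \<theta> s) = moved_dim w"
      using moved_dim_conj[OF gen_closed[OF s] wc] s by simp
    moreover have "bruhat_le W S w (s \<otimes> w \<otimes> \<theta> s)"
      using le by (rule bruhat_trans) (rule bruhat_gen_right, use wc s l1 l2 in simp_all)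
    ultimately show ?thesis unfolding tw st using l2 len_mult_theta[OF w s] l1 by simp
  qed
  then show "len (s \<otimes> twist w s) < len (twist w s)" and "twist (twist w s) s = w"
    and "len (twist w s) + moved_dim (twist w s) = len w + moved_dim w + 2"
    and "bruhat_le W S w (twist w s)" by blast+
qed

lemma twist_down:
  assumes w: "w \<in> tw_invs" and s: "s \<in> S" and down: "len (s \<otimes> w) < len w"
  shows "len (twist w s) < len (s \<otimes> twist w s)" and "twist (twist w s) s = w"
proof -
  have wc: "w \<in> carrier W" using w by (rule tw_invsD)
  have l1: "len w = Suc (len (s \<otimes> w))" using len_gen_mult[OF s wc] down by linarith
  have "len (twist w s) < len (s \<otimes> twist w s) \<and> twist (twist w s) s = w"
  proof (cases "s \<otimes> w \<otimes> \<theta> s = w")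
    case True
    then have comm: "s \<otimes> w = w \<otimes> \<theta> s" using commute_iff[OF wc s] by blast
    have tw: "twist w s = s \<otimes> w" using True by (simp add: twist_def)
    have "s \<otimes> (s \<otimes> w) \<otimes> \<theta> s = s \<otimes> w"
      by (simp only: gen_cancel(1)[OF s wc] comm[symmetric])
    then have "twist (s \<otimes> w) s = w" using wc s by (simp add: twist_def)
    then show ?thesis unfolding tw using down wc s by simp
  next
    case False
    have tw: "twist w s = s \<otimes> w \<otimes> \<theta> s" using False by (simp add: twist_def)
    note l2 = len_two_sided_down[OF w s down False]
    have st: "s \<otimes> (s \<otimes> w \<otimes> \<theta> s) = w \<otimes> \<theta> s" using wc s by (simp add: m_assoc)
    have "s \<otimes> (s \<otimes> w \<otimes> \<theta> s) \<otimes> \<theta> s = w" unfolding st using wc s by simp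
    then have "twist (s \<otimes> w \<otimes> \<theta> s) s = w" using False by (simp add: twist_def)
    then show ?thesis unfolding tw st using l1 l2 len_mult_theta[OF w s] by simp
  qed
  then show "len (twist w s) < len (s \<otimes> twist w s)" and "twist (twist w s) s = w" by blast+
qed

lemma twist_down_le:
  assumes w: "w \<in> tw_invs" and s: "s \<in> S" and down: "len (s \<otimes> w) < len w"
  shows "len w + moved_dim w = len (twist w s) + moved_dim (twist w s) + 2"
    and "bruhat_le W S (twist w s) w" and "len (twist w s) < len w"
proof -
  note up = twist_up[OF twist_in_tw_invs[OF w s] s twist_down(1)[OF w s down]]
  note tt = twist_down(2)[OF w s down]
  show "len w + moved_dim w = len (twist w s) + moved_dim (twist w s) + 2"
    using up(3) unfolding tt .
  show le: "bruhat_le W S (twist w s) w" using up(4) unfolding tt .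
  have "twist w s \<noteq> w" using twist_down(1)[OF w s down] down by auto
  then show "len (twist w s) < len w" by (rule bruhat_less_len[OF le])
qed

section \<open>The candidate for the rank\<close>

lemma one_in_tw_invs: "\<one> \<in> tw_invs"
  by (simp add: twisted_involutions_def)

text \<open>On the way down to the identity every step removes two from
  \<open>len w + moved_dim w\<close>. This also shows that \<open>moved_dim \<one>\<close> is at
  most this sum, so the subtraction and the division in \<open>tw_rank\<close> are exact.\<close>

lemma moved_dim_parity:
  assumes "w \<in> tw_invs" shows "\<exists>k. len w + moved_dim w = moved_dim \<one> + 2 * k"
  using assms
proof (induction "len w" arbitrary: w rule: less_induct)
  case less
  note wc = tw_invsD(1)[OF less.prems]
  show ?case
  proof (cases "w = \<one>")
    case True
    then show ?thesis by (intro exI[of _ 0]) simp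
  next
    case False
    then obtain s where s: "s \<in> S" "len (s \<otimes> w) < len w" using left_descent_exists wc by blast
    note d = twist_down_le[OF less.prems s]
    obtain k where "len (twist w s) + moved_dim (twist w s) = moved_dim \<one> + 2 * k"
      using less.hyps[OF d(3) twist_in_tw_invs[OF less.prems s(1)]] by blast
    then show ?thesis using d(1) by (intro exI[of _ "Suc k"]) simp
  qed
qed

definition tw_rank :: "'a \<Rightarrow> nat" where
  "tw_rank w = (len w + moved_dim w - moved_dim \<one>) div 2"

lemma tw_rank: assumes "w \<in> tw_invs" shows "len w + moved_dim w = moved_dim \<one> + 2 * tw_rank w"
  using moved_dim_parity[OF assms] by (auto simp: tw_rank_def)

lemma tw_rank_one: "tw_rank \<one> = 0"
  by (simp add: tw_rank_def)

lemma tw_rank_down: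
  assumes "w \<in> tw_invs" "s \<in> S" "len (s \<otimes> w) < len w" shows "tw_rank w = Suc (tw_rank (twist w s))"
  using tw_rank[OF assms(1)] tw_rank[OF twist_in_tw_invs[OF assms(1,2)]] twist_down_le(1)[OF assms]
  by simp

lemma tw_rank_up:
  assumes "w \<in> tw_invs" "s \<in> S" "len w < len (s \<otimes> w)" shows "tw_rank (twist w s) = Suc (tw_rank w)"
  using tw_rank[OF assms(1)] tw_rank[OF twist_in_tw_invs[OF assms(1,2)]] twist_up(3)[OF assms]
  by simp

section \<open>Lifting and coatoms among twisted involutions\<close>

lemma tw_lift:
  assumes x: "x \<in> tw_invs" and y: "y \<in> tw_invs" and le: "bruhat_le W S x y"
    and s: "s \<in> S" and dy: "len (s \<otimes> y) < len y" and ux: "len x < len (s \<otimes> x)"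
  shows "bruhat_le W S x (twist y s)" and "bruhat_le W S (twist x s) y"
proof -
  have ts: "\<theta> s \<in> S" using s by simp
  have c: "x \<in> carrier W" "y \<in> carrier W" using x y tw_invsD by blast+
  have "bruhat_le W S x (s \<otimes> y)" by (rule bruhat_lift[OF le s dy ux])
  \<comment> \<open>The left factor \<open>s\<close> and the right factor \<open>\<theta> s\<close>
    are lifted one after the other. The length drops by two in all, so \<open>\<theta> s\<close> is
    a right descent of \<open>s \<otimes> y\<close>.\<close>
  moreover have "bruhat_le W S x (s \<otimes> y \<otimes> \<theta> s)" if "s \<otimes> y \<otimes> \<theta> s \<noteq> y"
  proof (rule bruhat_lift_right[OF _ ts])
    show "bruhat_le W S x (s \<otimes> y)" by fact
    show "len (s \<otimes> y \<otimes> \<theta> s) < len (s \<otimes> y)"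
      using len_two_sided_down[OF y s dy that] len_gen_mult[OF s c(2)] by linarith
    show "len x < len (x \<otimes> \<theta> s)" using ux len_mult_theta[OF x s] by simp
  qed
  ultimately show "bruhat_le W S x (twist y s)" by (simp add: twist_def)
  have l: "bruhat_le W S (s \<otimes> x) y" by (rule bruhat_lift_le[OF le s dy])
  have "len (y \<otimes> \<theta> s) < len y" using dy len_mult_theta[OF y s] by simp
  then have "bruhat_le W S (s \<otimes> x \<otimes> \<theta> s) y" by (rule bruhat_lift_le_right[OF l ts])
  with l show "bruhat_le W S (twist x s) y" by (simp add: twist_def)
qed

lemma tw_lift_both:
  assumes x: "x \<in> tw_invs" and y: "y \<in> tw_invs" and le: "bruhat_le W S x y"
    and s: "s \<in> S" and dy: "len (s \<otimes> y) < len y" and dx: "len (s \<otimes> x) < len x"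
  shows "bruhat_le W S (twist x s) (twist y s)"
proof (rule tw_lift(1)[OF twist_in_tw_invs[OF x s] y _ s dy twist_down(1)[OF x s dx]])
  show "bruhat_le W S (twist x s) y" using twist_down_le(2)[OF x s dx] le by (rule bruhat_trans)
qed

text \<open>Iterated, this gives strict growth of the rank; on a cover it leaves only
  \<open>z = x\<close>. If the descent \<open>s\<close> of \<open>y\<close> is an ascent of
  \<open>x\<close>, then \<open>twist y s\<close> serves; otherwise the whole interval is twisted
  down by \<open>s\<close>, and the coatom found there has to be brought back.\<close>

lemma coatom_exists:
  assumes "x \<in> tw_invs" "y \<in> tw_invs" "bruhat_le W S x y" "x \<noteq> y"
  shows "\<exists>z\<in>tw_invs. bruhat_le W S x z \<and> bruhat_le W S z y \<and> tw_rank y = Suc (tw_rank z)"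
  using assms
proof (induction "len y" arbitrary: x y rule: less_induct)
  case less
  note x = less.prems(1) and y = less.prems(2)
  have yc: "y \<in> carrier W" and xc: "x \<in> carrier W" using x y tw_invsD by blast+
  have "y \<noteq> \<one>" using bruhat_less_len[OF less.prems(3,4)] by auto
  then obtain s where s: "s \<in> S" and dy: "len (s \<otimes> y) < len y"
    using left_descent_exists yc by blast
  note ty = twist_in_tw_invs[OF y s] and tx = twist_in_tw_invs[OF x s]
  note dd = twist_down_le[OF y s dy]
  have coatom: "\<exists>z\<in>tw_invs. bruhat_le W S x z \<and> bruhat_le W S z y \<and> tw_rank y = Suc (tw_rank z)"
    if "bruhat_le W S x (twist y s)"
    using that ty dd(2) tw_rank_down[OF y s dy] by blast
  show ?case
  proof (cases "len x < len (s \<otimes> x)")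
    case True
    then show ?thesis using coatom tw_lift(1)[OF x y less.prems(3) s dy] by blast
  next
    case False
    then have dx: "len (s \<otimes> x) < len x" using len_gen_mult[OF s xc] by linarith
    note ux = twist_down(1)[OF x s dx] and xx = twist_down(2)[OF x s dx]
    have "twist x s \<noteq> twist y s" using xx twist_down(2)[OF y s dy] less.prems(4) by metis
    then obtain z where z: "z \<in> tw_invs" "bruhat_le W S (twist x s) z" "bruhat_le W S z (twist y s)"
      "tw_rank (twist y s) = Suc (tw_rank z)"
      using less.hyps[OF dd(3) tx ty tw_lift_both[OF x y less.prems(3) s dy dx]] by blast
    have zc: "z \<in> carrier W" using z tw_invsD by blast
    have zy: "bruhat_le W S z y" using z(3) dd(2) by (rule bruhat_trans)
    \<comment> \<open>If \<open>s\<close> is an ascent of \<open>z\<close>, twisting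
      \<open>z\<close> up again gives a coatom below \<open>y\<close>. If it is a descent,
      \<open>z\<close> itself is above \<open>x\<close>, and then so is
      \<open>twist y s\<close>.\<close>
    show ?thesis
    proof (cases "len z < len (s \<otimes> z)")
      case True
      note zz = twist_up[OF z(1) s True]
      note tz = twist_in_tw_invs[OF z(1) s]
      have "bruhat_le W S (twist x s) (twist z s)" using z(2) zz(4) by (rule bruhat_trans)
      from tw_lift(2)[OF tx tz this s zz(1) ux] have "bruhat_le W S x (twist z s)" unfolding xx .
      moreover have "bruhat_le W S (twist z s) y" by (rule tw_lift(2)[OF z(1) y zy s dy True])
      moreover have "tw_rank y = Suc (tw_rank (twist z s))"
        using tw_rank_down[OF y s dy] z(4) tw_rank_up[OF z(1) s True] by simp
      ultimately show ?thesis using tz by blast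
    next
      case False
      then have dz: "len (s \<otimes> z) < len z" using len_gen_mult[OF s zc] by linarith
      from tw_lift(2)[OF tx z(1,2) s dz ux] have "bruhat_le W S x z" unfolding xx .
      then have "bruhat_le W S x (twist y s)" using z(3) by (rule bruhat_trans)
      then show ?thesis by (rule coatom)
    qed
  qed
qed

lemma tw_rank_strict_mono:
  assumes "x \<in> tw_invs" "y \<in> tw_invs" "bruhat_le W S x y" "x \<noteq> y"
  shows "tw_rank x < tw_rank y"
  using assms
proof (induction "tw_rank y" arbitrary: y rule: less_induct)
  case less
  then obtain z where z: "z \<in> tw_invs" "bruhat_le W S x z" "tw_rank y = Suc (tw_rank z)"
    using coatom_exists[of x y] by blast
  show ?case
  proof (cases "x = z")
    case False
    then have "tw_rank x < tw_rank z" using less.hyps[of z] z less.prems(1) by simp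
    then show ?thesis using z by simp
  qed (use z in simp)
qed

section \<open>The twisted absolute length\<close>

lemma moved_dim_twisted_identity:
  "u \<in> twisted_identities W \<theta> \<Longrightarrow> moved_dim u = moved_dim \<one>"
  using moved_dim_conj[OF _ one_closed] by (auto simp: twisted_identities_def)

text \<open>Kept letters are absorbed into the prefix \<open>x\<close>, so a deleted letter always
  stands directly behind the prefix, where \<open>moved_dim_insert_le\<close> applies.\<close>

lemma moved_dim_subseq:
  assumes "subseq ts ss" "ss \<in> lists S" "x \<in> carrier W"
  shows "moved_dim (x \<otimes> word_prod W ss) + length ts \<le> moved_dim (x \<otimes> word_prod W ts) + length ss"
  using assms
proof (induction arbitrary: x rule: list_emb.induct)
  case (list_emb_Nil ys)
  then have ys: "ys \<in> lists S" by simp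
  have "moved_dim (x \<otimes> word_prod W ys) \<le> moved_dim x + length ys"
    using ys list_emb_Nil(2)
  proof (induction arbitrary: x rule: lists.induct)
    case (Cons y ys)
    show ?case
      using moved_dim_insert_le[OF Cons(4) word_prod_closed[OF Cons(2)] Cons(1)] Cons(3)[OF Cons(4)]
      by simp
  qed simp
  then show ?case using list_emb_Nil by simp
next
  case (list_emb_Cons xs ys y)
  then have ys: "y \<in> S" "ys \<in> lists S" by simp_all
  show ?case
    using moved_dim_insert_le[OF list_emb_Cons.prems(2) word_prod_closed[OF ys(2)] ys(1)]
      list_emb_Cons.IH[OF ys(2) list_emb_Cons.prems(2)]
    by simp
next
  case (list_emb_Cons2 x' y xs ys)
  then have ys: "y \<in> S" "ys \<in> lists S" "x' = y" by simp_all
  then have xs: "xs \<in> lists S" using list_emb_Cons2 subseq_in_lists by blast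
  have "x \<otimes> y \<in> carrier W" using ys list_emb_Cons2.prems by simp
  from list_emb_Cons2.IH[OF ys(2) this] show ?case
    using ys xs list_emb_Cons2.prems by (simp add: m_assoc)
qed

text \<open>The downward twists are turned into words. A conjugating step puts \<open>s\<close> in
  front and \<open>\<theta> s\<close> at the end of both words, which keeps the product of the
  shorter one a twisted identity; a commuting step puts \<open>s\<close> in front of the longer word
  only. The length of the element grows by the number of letters added, so the longer word stays
  reduced.\<close>

lemma deletion_to_twisted_identity:
  assumes "w \<in> tw_invs"
  shows "\<exists>ss ts. reduced_expression W S w ss \<and> subseq ts ss \<and>
    word_prod W ts \<in> twisted_identities W \<theta> \<and> length ts + moved_dim w = length ss + moved_dim \<one>"
  using assms
proof (induction "len w" arbitrary: w rule: less_induct)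
  case less
  note w = less.prems and wc = tw_invsD(1)[OF less.prems]
  show ?case
  proof (cases "w = \<one>")
    case True
    have "\<one> \<in> twisted_identities W \<theta>"
      unfolding twisted_identities_def by (rule CollectI, rule exI[of _ \<one>]) simp
    then show ?thesis
      unfolding True by (intro exI[of _ "[]"]) (simp add: reduced_expression_def)
  next
    case False
    then obtain s where s: "s \<in> S" and down: "len (s \<otimes> w) < len w" using left_descent_exists wc by blast
    define u where "u = twist w s"
    have u: "u \<in> tw_invs" unfolding u_def by (rule twist_in_tw_invs[OF w s])
    have uc: "u \<in> carrier W" using u by (rule tw_invsD)
    have up: "len u < len (s \<otimes> u)" unfolding u_def by (rule twist_down(1)[OF w s down])
    have u_twist: "twist u s = w" unfolding u_def by (rule twist_down(2)[OF w s down])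
    obtain ss ts where IH: "reduced_expression W S u ss" "subseq ts ss"
      "word_prod W ts \<in> twisted_identities W \<theta>" "length ts + moved_dim u = length ss + moved_dim \<one>"
      using less.hyps[OF _ u] twist_down_le(3)[OF w s down] unfolding u_def by blast
    have ss: "ss \<in> lists S" "word_prod W ss = u" "length ss = len u"
      using IH(1) by (simp_all add: reduced_expression_def)
    have ts: "ts \<in> lists S" using IH(2) ss(1) by (rule subseq_in_lists)
    show ?thesis
    proof (cases "s \<otimes> u \<otimes> \<theta> s = u")
      case True
      then have wu: "w = s \<otimes> u" using u_twist by (simp add: twist_def)
      have comm: "s \<otimes> u = u \<otimes> \<theta> s" using True commute_iff[OF uc s] by blast
      have "len w = Suc (len u)" unfolding wu using len_gen_mult[OF s uc] up by linarith
      then have "reduced_expression W S w (s # ss)"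
        using ss s wu by (simp add: reduced_expression_def)
      moreover have "length ts + moved_dim w = length (s # ss) + moved_dim \<one>"
        using moved_dim_Suc[OF u s comm up] IH(4) unfolding wu by simp
      ultimately show ?thesis using IH(2,3) list_emb_Cons by blast
    next
      case False
      then have wu: "w = s \<otimes> u \<otimes> \<theta> s" using u_twist by (simp add: twist_def)
      have lw: "len w = len u + 2" unfolding wu by (rule len_two_sided_up[OF u s up False])
      have "reduced_expression W S w (s # ss @ [\<theta> s])"
        using ss s wu lw uc by (simp add: reduced_expression_def m_assoc)
      moreover have "subseq (s # ts @ [\<theta> s]) (s # ss @ [\<theta> s])" using IH(2) by simp
      moreover have "word_prod W (s # ts @ [\<theta> s]) \<in> twisted_identities W \<theta>"
      proof -
        obtain x where x: "x \<in> carrier W" "word_prod W ts = x \<otimes> \<theta> (inv x)"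
          using IH(3) unfolding twisted_identities_def by blast
        have "word_prod W (s # ts @ [\<theta> s]) = (s \<otimes> x) \<otimes> \<theta> (inv (s \<otimes> x))"
          using x s ts by (simp add: inv_mult_group theta_mult m_assoc)
        then show ?thesis using x(1) s unfolding twisted_identities_def by blast
      qed
      moreover have "length (s # ts @ [\<theta> s]) + moved_dim w = length (s # ss @ [\<theta> s]) + moved_dim \<one>"
        using moved_dim_conj[OF gen_closed[OF s] uc] IH(4) s unfolding wu by simp
      ultimately show ?thesis by blast
    qed
  qed
qed

text \<open>\<open>moved_dim_subseq\<close> bounds the number of deletions from below in every
  reduced expression of \<open>w\<close>, and \<open>deletion_to_twisted_identity\<close> attains
  the bound in one of them, as the minimum over all requires.\<close>

lemma twisted_absolute_length_eq:
  assumes "w \<in> tw_invs"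
  shows "twisted_absolute_length W S \<theta> w + moved_dim \<one> = moved_dim w"
proof -
  obtain ss ts where st: "reduced_expression W S w ss" "subseq ts ss"
    "word_prod W ts \<in> twisted_identities W \<theta>" "length ts + moved_dim w = length ss + moved_dim \<one>"
    using deletion_to_twisted_identity[OF assms] by blast
  have "length ts \<le> length ss" using st(2) by (rule list_emb_length)
  then have le: "moved_dim \<one> \<le> moved_dim w" using st(4) by linarith
  have "twisted_absolute_length W S \<theta> w = moved_dim w - moved_dim \<one>"
    unfolding twisted_absolute_length_def
  proof (rule Least_equality)
    have "length ts + (moved_dim w - moved_dim \<one>) = length ss" using st(4) le by linarith
    then show "\<exists>ss ts. reduced_expression W S w ss \<and> subseq ts ss \<and>
        length ts + (moved_dim w - moved_dim \<one>) = length ss \<and> word_prod W ts \<in> twisted_identities W \<theta>"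
      using st by blast
  next
    fix d assume "\<exists>ss ts. reduced_expression W S w ss \<and> subseq ts ss \<and>
        length ts + d = length ss \<and> word_prod W ts \<in> twisted_identities W \<theta>"
    then obtain us vs where h: "reduced_expression W S w us" "subseq vs us"
      "length vs + d = length us" "word_prod W vs \<in> twisted_identities W \<theta>" by blast
    have us: "us \<in> lists S" "word_prod W us = w" using h(1) by (simp_all add: reduced_expression_def)
    have "vs \<in> lists S" using h(2) us(1) by (rule subseq_in_lists)
    then have "moved_dim w + length vs \<le> moved_dim \<one> + length us"
      using moved_dim_subseq[OF h(2) us(1) one_closed] moved_dim_twisted_identity[OF h(4)] us
        tw_invsD(1)[OF assms] by simp
    then show "moved_dim w - moved_dim \<one> \<le> d" using h(3) by linarith
  qed
  then show ?thesis using le by simp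
qed

section \<open>The poset and its rank function\<close>

abbreviation Br :: "'a gorder" where "Br \<equiv> Br_twisted_involutions W S \<theta>"

lemma Br_simps [simp]: "carrier Br = tw_invs" "eq Br = (=)" "le Br = bruhat_le W S"
  by (simp_all add: Br_twisted_involutions_def)

lemma Br_less: "lless Br x y \<longleftrightarrow> bruhat_le W S x y \<and> x \<noteq> y"
  by (simp add: lless_def)

lemma Br_partial_order: "partial_order Br"
  by unfold_locales (auto simp: tw_invsD(1) bruhat_refl dest: bruhat_antisym intro: bruhat_trans)

lemma tw_rank_is_rank_function: "rank_function Br tw_rank"
  unfolding rank_function_def Br_less Br_simps
proof (intro conjI ballI allI impI)
  fix x assume "x \<in> tw_invs" "\<not> (\<exists>y\<in>tw_invs. bruhat_le W S y x \<and> y \<noteq> x)"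
  then have "x = \<one>" using one_in_tw_invs bruhat_one[OF tw_invsD(1)] by blast
  then show "tw_rank x = 0" by (simp add: tw_rank_one)
next
  fix x y assume "x \<in> tw_invs" "y \<in> tw_invs" "bruhat_le W S x y \<and> x \<noteq> y"
  then show "tw_rank x < tw_rank y" using tw_rank_strict_mono by blast
next
  fix x y assume "covered_by Br x y"
  then have xy: "x \<in> tw_invs" "y \<in> tw_invs" "bruhat_le W S x y" "x \<noteq> y"
    and no: "\<And>z. z \<in> tw_invs \<Longrightarrow> bruhat_le W S x z \<Longrightarrow> x \<noteq> z \<Longrightarrow> bruhat_le W S z y \<Longrightarrow> z = y"
    unfolding covered_by_def Br_less Br_simps by blast+
  \<comment> \<open>The coatom lies above \<open>x\<close> and strictly below \<open>y\<close>, so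
    the cover relation identifies it with \<open>x\<close>.\<close>
  obtain z where z: "z \<in> tw_invs" "bruhat_le W S x z" "bruhat_le W S z y" "tw_rank y = Suc (tw_rank z)"
    using coatom_exists[OF xy] by blast
  then have "z \<noteq> y" by auto
  then have "x = z" using no z by blast
  then show "tw_rank y = Suc (tw_rank x)" using z by simp
qed

lemma Br_least_one: "least Br \<one> (carrier Br)"
  using one_in_tw_invs bruhat_one tw_invsD(1) by (auto simp: least_def)

lemma Br_rank:
  assumes "w \<in> tw_invs"
  shows "2 * poset_rank Br w = len w + twisted_absolute_length W S \<theta> w"
proof -
  have "poset_rank Br w = tw_rank w"
    using poset_rank_eq[OF tw_rank_is_rank_function, of w] assms by simp
  then show ?thesis using tw_rank[OF assms] twisted_absolute_length_eq[OF assms] by linarith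
qed

end

theorem theorem4p8:
  fixes W :: "('a, 'b) monoid_scheme" and S :: "'a set" and \<theta> :: "'a \<Rightarrow> 'a"
  assumes "coxeter_system W S"
    and "finite S"
    and "\<theta> \<in> iso W W"
    and "\<And>x. x \<in> carrier W \<Longrightarrow> \<theta> (\<theta> x) = x"
    and "\<theta> ` S = S"
  shows "graded_poset (Br_twisted_involutions W S \<theta>) \<and>
    least (Br_twisted_involutions W S \<theta>) \<one>\<^bsub>W\<^esub> (carrier (Br_twisted_involutions W S \<theta>)) \<and>
    (\<forall>w \<in> twisted_involutions W \<theta>.
       real (poset_rank (Br_twisted_involutions W S \<theta>) w) =
         (real (coxeter_length W S w) + real (twisted_absolute_length W S \<theta> w)) / 2)"
proof -
  have "group W" using assms(1) by (simp add: coxeter_system_def)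
  then interpret group W .
  interpret twisted_coxeter_group W S \<theta>
    using assms by unfold_locales auto
  have "graded_poset Br"
    unfolding graded_poset_def using Br_partial_order tw_rank_is_rank_function by blast
  moreover have "real (poset_rank Br w) = (real (len w) + real (twisted_absolute_length W S \<theta> w)) / 2"
    if "w \<in> tw_invs" for w
  proof -
    have "real (2 * poset_rank Br w) = real (len w + twisted_absolute_length W S \<theta> w)"
      by (simp only: Br_rank[OF that])
    then show ?thesis by simp
  qed
  ultimately show ?thesis using Br_least_one by blast
qed

end
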